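(* Let $\mathbf{x}\in\mathbb{R}^{r_1}$, $\mathbf{y}\in\mathbb{R}^{r_2}$, $\mathbf{z}\in\mathbb{R}^{r_3}$, and let $\phi(\mathbf{x},\mathbf{y})=\bigwedge_{i=1}^m f_i(\mathbf{x},\mathbf{y})\ge0$ and $\psi(\mathbf{x},\mathbf{z})=\bigwedge_{j=1}^n g_j(\mathbf{x},\mathbf{z})\ge0$ with $f_i\in\mathbb{R}[\mathbf{x},\mathbf{y}]$, $g_j\in\mathbb{R}[\mathbf{x},\mathbf{z}]$; let $S_\phi\subseteq\mathbb{R}^{r_1+r_2}$, $S_\psi\subseteq\mathbb{R}^{r_1+r_3}$ be the corresponding basic semialgebraic sets. Let $S_1=\mathrm{cl}(P_{\mathbf{x}}(S_\phi))$ and $S_2=\mathrm{cl}(P_{\mathbf{x}}(S_\psi))$, where $P_{\mathbf{x}}$ is projection onto the $\mathbf{x}$-coordinates, written as finite unions of closed basic semialgebraic sets, with $\tilde S_1,\tilde S_2$ the unions of the corresponding sets $\tilde S$ (defined below). Let $w$ be a fresh variable, let $\tilde f_i,\tilde g_j$ be the homogenizations of $f_i,g_j$, and set $\tilde f_{m+1}=\tilde g_{n+1}=x_0$, $\tilde f_{m+2}=\tilde g_{n+2}=w$, $\tilde f_{m+3}=x_0^2+\|\mathbf{x}\|^2+w^2+\|\mathbf{y}\|^2-1$, $\tilde g_{n+3}=x_0^2+\|\mathbf{x}\|^2+w^2+\|\mathbf{z}\|^2-1$, $\tilde f_{m+4}=\tilde g_{n+4}=x_0^2+\|\mathbf{x}\|^2-w^2$.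 Assume (1) $\tilde S_1\cap\tilde S_2=\emptyset$ and (2) $S_\phi$ and $S_\psi$ are closed at $\infty$. Then there exist polynomials $h_1,h_2\in\mathbb{R}[\mathbf{x}]$ such that $h(\mathbf{x})=h_1(\mathbf{x})+\sqrt{\|\mathbf{x}\|^2+1}\,h_2(\mathbf{x})$ is an interpolant function of $\phi$ and $\psi$ (i.e. $h(\mathbf{x})>0$ whenever $\phi(\mathbf{x},\mathbf{y})$ holds and $h(\mathbf{x})<0$ whenever $\psi(\mathbf{x},\mathbf{z})$ holds), and such that the polynomial $l(\mathbf{x},w)=h_1(\mathbf{x})+w\,h_2(\mathbf{x})$ satisfies, for every (arbitrarily small) $\epsilon>0$, $\tilde l(x_0,\mathbf{x},w)+\epsilon=\sigma_0+\sum_{i=1}^{m+4}\sigma_i\tilde f_i$ and $-\tilde l(x_0,\mathbf{x},w)+\epsilon=\tau_0+\sum_{j=1}^{n+4}\tau_j\tilde g_j$ for some $\sigma_0,\dots,\sigma_{m+2}\in\Sigma[x_0,\mathbf{x},\mathbf{y},w]$, $\sigma_{m+3},\sigma_{m+4}\in\mathbb{R}[x_0,\mathbf{x},\mathbf{y},w]$, $\tau_0,\dots,\tau_{n+2}\in\Sigma[x_0,\mathbf{x},\mathbf{z},w]$, $\tau_{n+3},\tau_{n+4}\in\mathbb{R}[x_0,\mathbf{x},\mathbf{z},w]$.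
   Context: For a polynomial $f$ in variables $\mathbf{u}=(u_1,\dots,u_s)$ of total degree $d_f$, its homogenization is $\tilde f(x_0,\mathbf{u})=x_0^{d_f}f(u_1/x_0,\dots,u_s/x_0)$ with a fresh variable $x_0$ (so $\tilde l$ is the homogenization of $l$ in the variables $(\mathbf{x},w)$). $\Sigma[\mathbf{u}]$ is the set of finite sums of squares of polynomials in $\mathbb{R}[\mathbf{u}]$; $\mathrm{cl}$ is topological closure. For a closed basic semialgebraic set $S=\{\mathbf{u}\in\mathbb{R}^s\mid p_1(\mathbf{u})\ge0,\dots,p_k(\mathbf{u})\ge0\}$ define $\tilde S=\{(x_0,\mathbf{u})\mid \tilde p_1\ge0,\dots,\tilde p_k\ge0,\ x_0\ge0,\ x_0^2+\|\mathbf{u}\|^2=1\}$ and $\tilde S^h$ the same set with $x_0\ge0$ replaced by $x_0>0$; $S$ is called closed at $\infty$ if $\mathrm{cl}(\tilde S^h)=\tilde S$. *)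

theory Defs
  imports "HOL-Analysis.Analysis" "HOL-Library.Poly_Mapping"
begin

text \<open>Real polynomials in variables of type \<open>'v\<close>: finitely supported maps from monomials
  (finitely supported exponent vectors) to coefficients, with the convolution product of
  \<^theory>\<open>HOL-Library.Poly_Mapping\<close>.\<close>

type_synonym 'v mpoly = "('v \<Rightarrow>\<^sub>0 nat) \<Rightarrow>\<^sub>0 real"

definition Const :: "real \<Rightarrow> 'v mpoly" where
  "Const c = Poly_Mapping.single 0 c"

definition Var :: "'v \<Rightarrow> 'v mpoly" where
  "Var v = Poly_Mapping.single (Poly_Mapping.single v 1) 1"

definition eval :: "('v \<Rightarrow> real) \<Rightarrow> 'v mpoly \<Rightarrow> real" where
  "eval u p = (\<Sum>a\<in>Poly_Mapping.keys p.
     Poly_Mapping.lookup p a * (\<Prod>v\<in>Poly_Mapping.keys a. u v ^ Poly_Mapping.lookup a v))"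

text \<open>The polynomial ring \<open>\<real>[V]\<close>, as a subring of the ring of all polynomials over \<open>'v\<close>.\<close>

definition polys :: "'v set \<Rightarrow> 'v mpoly set" where
  "polys V = {p. \<forall>a\<in>Poly_Mapping.keys p. Poly_Mapping.keys a \<subseteq> V}"

definition sos :: "'v set \<Rightarrow> 'v mpoly set" where
  "sos V = {(\<Sum>q\<leftarrow>qs. q\<^sup>2) | qs. set qs \<subseteq> polys V}"

definition mono_degree :: "('v \<Rightarrow>\<^sub>0 nat) \<Rightarrow> nat" where
  "mono_degree a = (\<Sum>v\<in>Poly_Mapping.keys a. Poly_Mapping.lookup a v)"

text \<open>The zero polynomial gets degree 0; its homogenization is 0 in any case.\<close>

definition total_degree :: "'v mpoly \<Rightarrow> nat" where
  "total_degree p = Max (insert 0 (mono_degree ` Poly_Mapping.keys p))"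

text \<open>Each monomial is multiplied by the power of \<open>x0\<close> that raises its degree to the total
  degree; \<open>eval_homogenize\<close> below gives the formula \<open>x0 ^ d * p (u / x0)\<close>.\<close>

definition homogenize :: "'v \<Rightarrow> 'v mpoly \<Rightarrow> 'v mpoly" where
  "homogenize x0 p = (\<Sum>a\<in>Poly_Mapping.keys p.
     Poly_Mapping.single (a + Poly_Mapping.single x0 (total_degree p - mono_degree a))
       (Poly_Mapping.lookup p a))"

text \<open>A point of \<open>\<real>\<^sup>V\<close> is a function that vanishes outside \<open>V\<close>. For finite \<open>V\<close> this is a
  closed subspace of \<open>'v \<Rightarrow> real\<close> whose topology (that of pointwise convergence) is the
  Euclidean one, so \<^const>\<open>closure\<close> is the Euclidean closure.\<close>

definition space_on :: "'v set \<Rightarrow> ('v \<Rightarrow> real) set" where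
  "space_on V = {u. \<forall>v. v \<notin> V \<longrightarrow> u v = 0}"

definition proj :: "'v set \<Rightarrow> ('v \<Rightarrow> real) \<Rightarrow> ('v \<Rightarrow> real)" where
  "proj V u = (\<lambda>v. if v \<in> V then u v else 0)"

definition norm2 :: "'v set \<Rightarrow> ('v \<Rightarrow> real) \<Rightarrow> real" where
  "norm2 V u = (\<Sum>v\<in>V. (u v)\<^sup>2)"

definition norm2_poly :: "'v set \<Rightarrow> 'v mpoly" where
  "norm2_poly V = (\<Sum>v\<in>V. (Var v)\<^sup>2)"

definition semialg :: "'v set \<Rightarrow> 'v mpoly set \<Rightarrow> ('v \<Rightarrow> real) set" where
  "semialg V P = {u \<in> space_on V. \<forall>p\<in>P. 0 \<le> eval u p}"

text \<open>The sets \<open>S~\<close> and \<open>S~\<^sup>h\<close> depend on the polynomials describing \<open>S\<close>, not only on \<open>S\<close>.\<close>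

definition semialg_tilde :: "'v \<Rightarrow> 'v set \<Rightarrow> 'v mpoly set \<Rightarrow> ('v \<Rightarrow> real) set" where
  "semialg_tilde x0 V P = {u \<in> space_on (insert x0 V).
     (\<forall>p\<in>P. 0 \<le> eval u (homogenize x0 p)) \<and> 0 \<le> u x0 \<and> (u x0)\<^sup>2 + norm2 V u = 1}"

definition semialg_tilde_h :: "'v \<Rightarrow> 'v set \<Rightarrow> 'v mpoly set \<Rightarrow> ('v \<Rightarrow> real) set" where
  "semialg_tilde_h x0 V P = {u \<in> space_on (insert x0 V).
     (\<forall>p\<in>P. 0 \<le> eval u (homogenize x0 p)) \<and> 0 < u x0 \<and> (u x0)\<^sup>2 + norm2 V u = 1}"

definition closed_at_infinity :: "'v \<Rightarrow> 'v set \<Rightarrow> 'v mpoly set \<Rightarrow> bool" where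
  "closed_at_infinity x0 V P \<longleftrightarrow> closure (semialg_tilde_h x0 V P) = semialg_tilde x0 V P"

text \<open>\<open>PP\<close> writes \<open>S\<close> as a finite union of closed basic semialgebraic subsets of \<open>\<real>\<^sup>V\<close>.\<close>

definition semialg_union :: "'v set \<Rightarrow> 'v mpoly set set \<Rightarrow> ('v \<Rightarrow> real) set \<Rightarrow> bool" where
  "semialg_union V PP S \<longleftrightarrow>
     finite PP \<and> (\<forall>P\<in>PP. finite P \<and> P \<subseteq> polys V) \<and> S = (\<Union>P\<in>PP. semialg V P)"

datatype var = X0 | X nat | Y nat | Z nat | W

definition xvars :: "nat \<Rightarrow> var set" where "xvars r = X ` {1..r}"
definition yvars :: "nat \<Rightarrow> var set" where "yvars r = Y ` {1..r}"
definition zvars :: "nat \<Rightarrow> var set" where "zvars r = Z ` {1..r}"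

text \<open>The family \<open>f~\<^sub>1, \<dots>, f~\<^sub>m\<^sub>+\<^sub>4\<close>, where \<open>V\<close> is the set of \<open>\<^bold>x\<close>-variables and \<open>U\<close> the set of
  \<open>\<^bold>y\<close>-variables (for the \<open>g~\<^sub>j\<close>: of \<open>\<^bold>z\<close>-variables).\<close>

definition ext_family :: "var set \<Rightarrow> var set \<Rightarrow> nat \<Rightarrow> (nat \<Rightarrow> var mpoly) \<Rightarrow> nat \<Rightarrow> var mpoly" where
  "ext_family V U m f i =
     (if i \<le> m then homogenize X0 (f i)
      else if i = m + 1 then Var X0
      else if i = m + 2 then Var W
      else if i = m + 3 then (Var X0)\<^sup>2 + norm2_poly V + (Var W)\<^sup>2 + norm2_poly U - 1
      else (Var X0)\<^sup>2 + norm2_poly V - (Var W)\<^sup>2)"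

definition interpolant ::
  "var set \<Rightarrow> (var \<Rightarrow> real) set \<Rightarrow> (var \<Rightarrow> real) set \<Rightarrow> ((var \<Rightarrow> real) \<Rightarrow> real) \<Rightarrow> bool" where
  "interpolant V S T h \<longleftrightarrow> (\<forall>u\<in>S. 0 < h (proj V u)) \<and> (\<forall>u\<in>T. h (proj V u) < 0)"

lemma eval_superset:
  assumes "finite A" "Poly_Mapping.keys p \<subseteq> A"
  shows "eval u p = (\<Sum>a\<in>A. Poly_Mapping.lookup p a *
           (\<Prod>v\<in>Poly_Mapping.keys a. u v ^ Poly_Mapping.lookup a v))"
  unfolding eval_def using assms
  by (intro sum.mono_neutral_left) (auto simp: in_keys_iff)

lemma eval_zero: "eval u 0 = 0"
  by (simp add: eval_def)

lemma eval_add: "eval u (p + q) = eval u p + eval u q"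
proof -
  let ?A = "Poly_Mapping.keys p \<union> Poly_Mapping.keys q"
  have "Poly_Mapping.keys (p + q) \<subseteq> ?A" by (rule Poly_Mapping.keys_add)
  then show ?thesis
    by (simp add: eval_superset[of ?A] lookup_add distrib_right sum.distrib)
qed

lemma eval_sum: "eval u (\<Sum>i\<in>I. p i) = (\<Sum>i\<in>I. eval u (p i))"
  by (induction I rule: infinite_finite_induct) (auto simp: eval_zero eval_add)

lemma eval_single: "eval u (Poly_Mapping.single a c) =
    c * (\<Prod>v\<in>Poly_Mapping.keys a. u v ^ Poly_Mapping.lookup a v)"
  by (simp add: eval_def)

lemma prod_keys_superset:
  fixes u :: "'v \<Rightarrow> real"
  assumes "finite A" "Poly_Mapping.keys a \<subseteq> A"
  shows "(\<Prod>v\<in>Poly_Mapping.keys a. u v ^ Poly_Mapping.lookup a v) =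
         (\<Prod>v\<in>A. u v ^ Poly_Mapping.lookup a v)"
  using assms by (intro prod.mono_neutral_left) (auto simp: in_keys_iff)

lemma prod_keys_add:
  fixes u :: "'v \<Rightarrow> real"
  shows "(\<Prod>v\<in>Poly_Mapping.keys (a + b). u v ^ Poly_Mapping.lookup (a + b) v) =
         (\<Prod>v\<in>Poly_Mapping.keys a. u v ^ Poly_Mapping.lookup a v) *
         (\<Prod>v\<in>Poly_Mapping.keys b. u v ^ Poly_Mapping.lookup b v)"
proof -
  let ?A = "Poly_Mapping.keys a \<union> Poly_Mapping.keys b"
  have "Poly_Mapping.keys (a + b) \<subseteq> ?A" by (rule Poly_Mapping.keys_add)
  then show ?thesis
    by (subst (1 2 3) prod_keys_superset[of ?A])
       (auto simp: lookup_add power_add prod.distrib)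
qed

lemma eval_homogenize:
  assumes "u x0 \<noteq> 0"
  shows "eval u (homogenize x0 p) = u x0 ^ total_degree p * eval (\<lambda>v. u v / u x0) p"
proof -
  have "c * (\<Prod>v\<in>Poly_Mapping.keys (a + Poly_Mapping.single x0 (total_degree p - mono_degree a)).
          u v ^ Poly_Mapping.lookup (a + Poly_Mapping.single x0 (total_degree p - mono_degree a)) v)
     = u x0 ^ total_degree p *
       (c * (\<Prod>v\<in>Poly_Mapping.keys a. (u v / u x0) ^ Poly_Mapping.lookup a v))"
    if a: "a \<in> Poly_Mapping.keys p" for a c
  proof -
    have le: "mono_degree a \<le> total_degree p"
      using a by (auto simp: total_degree_def)
    have "(\<Prod>v\<in>Poly_Mapping.keys a. (u v / u x0) ^ Poly_Mapping.lookup a v) =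
          (\<Prod>v\<in>Poly_Mapping.keys a. u v ^ Poly_Mapping.lookup a v) / u x0 ^ mono_degree a"
      by (simp add: power_divide prod_dividef mono_degree_def power_sum)
    then show ?thesis
      using assms le by (simp add: prod_keys_add power_diff)
  qed
  then show ?thesis
    unfolding homogenize_def eval_sum eval_single eval_def[of _ p] sum_distrib_left
    by (intro sum.cong) simp_all
qed

end

theory Submission
  imports Defs
begin

text \<open>Interpolant: for \<open>s = sqrt (|x|^2 + 1)\<close>, the point \<open>(1, x) / s\<close> lies in one of the two disjoint
  compact sets \<open>S~\<^sub>1\<close>, \<open>S~\<^sub>2\<close>, which some polynomial \<open>q\<close> separates by Stone--Weierstrass; clearing
  denominators and using \<open>s^2 = |x|^2 + 1\<close> turns \<open>q ((1, x) / s)\<close> into \<open>h1 + s h2\<close>.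

  Certificate: by closedness at infinity the homogenized \<open>l\<close> is nonnegative on the set described
  by the extended family, so its sum with \<open>\<epsilon>\<close> is positive there and Putinar's theorem applies.
  That theorem is proved directly. Subtracting suitable square multiples of the constraints yields
  a polynomial that is positive on a whole cube. It lies in every preordering \<open>T\<close> that contains the
  elements \<open>1 \<plusminus> u\<close> for the variables \<open>u\<close>: modulo \<open>T\<close> it is bounded below, near each point \<open>a\<close>,
  by a constant minus \<open>\<kappa> |u - a|^2\<close>, and averaging over random grid points \<open>a\<close> with mean \<open>u\<close>
  replaces the quadratic term by an arbitrarily small variance.\<close>

text \<open>Over a countable index type the product topology on real functions is metrizable; the
  approximation results below are stated for such types.\<close>

instance var :: countable
  by countable_datatype

section \<open>The polynomial rings\<close>

lemma Const_add: "Const (a + b) = Const a + Const b"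
  by (simp add: Const_def single_add)

lemma Const_uminus: "Const (- a) = - Const a"
  by (simp add: Const_def single_uminus)

lemma Const_diff: "Const (a - b) = Const a - Const b"
  by (simp add: Const_def single_diff)

lemma Const_mult: "Const (a * b) = Const a * Const b"
  by (simp add: Const_def mult_single)

lemma Const_0: "Const 0 = 0"
  by (simp add: Const_def)

lemma Const_1: "Const 1 = 1"
  by (simp add: Const_def)

lemma Const_power: "Const (a ^ n) = Const a ^ n"
  by (induction n) (auto simp: Const_1 Const_mult)

lemma poly_mapping_eq_sum_single:
  "p = (\<Sum>a\<in>Poly_Mapping.keys p. Poly_Mapping.single a (Poly_Mapping.lookup p a))"
proof (rule poly_mapping_eqI)
  fix k
  have "(\<Sum>a\<in>Poly_Mapping.keys p. (Poly_Mapping.lookup p a when a = k)) = Poly_Mapping.lookup p k"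
  proof (cases "k \<in> Poly_Mapping.keys p")
    case True
    then show ?thesis
      by (subst sum.remove[OF _ True]) (auto intro!: sum.neutral)
  next
    case False
    then show ?thesis
      by (auto simp: in_keys_iff when_def intro!: sum.neutral)
  qed
  then show "Poly_Mapping.lookup p k = Poly_Mapping.lookup
      (\<Sum>a\<in>Poly_Mapping.keys p. Poly_Mapping.single a (Poly_Mapping.lookup p a)) k"
    by (simp add: lookup_sum lookup_single)
qed

lemma eval_mult: "eval u (p * q) = eval u p * eval u q"
proof -
  let ?m = "\<lambda>a. \<Prod>v\<in>Poly_Mapping.keys a. u v ^ Poly_Mapping.lookup a v"
  have "p * q = (\<Sum>a\<in>Poly_Mapping.keys p. \<Sum>b\<in>Poly_Mapping.keys q.
      Poly_Mapping.single (a + b) (Poly_Mapping.lookup p a * Poly_Mapping.lookup q b))"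
    by (subst poly_mapping_eq_sum_single[of p], subst poly_mapping_eq_sum_single[of q])
       (simp add: sum_product mult_single)
  then have "eval u (p * q) = (\<Sum>a\<in>Poly_Mapping.keys p. \<Sum>b\<in>Poly_Mapping.keys q.
      Poly_Mapping.lookup p a * Poly_Mapping.lookup q b * (?m a * ?m b))"
    by (simp add: eval_sum eval_single prod_keys_add)
  also have "\<dots> = eval u p * eval u q"
    by (simp add: eval_def sum_product algebra_simps)
  finally show ?thesis .
qed

lemma eval_Const: "eval u (Const c) = c"
  by (simp add: Const_def eval_single)

lemma eval_Var: "eval u (Var v) = u v"
  by (simp add: Var_def eval_single)

lemma eval_1: "eval u 1 = 1"
  by (simp add: Const_1[symmetric] eval_Const)

lemma eval_uminus: "eval u (- p) = - eval u p"
  using eval_add[of u p "- p"] by (simp add: eval_zero)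

lemma eval_diff: "eval u (p - q) = eval u p - eval u q"
  using eval_add[of u p "- q"] by (simp add: eval_uminus)

lemma eval_power: "eval u (p ^ n) = eval u p ^ n"
  by (induction n) (auto simp: eval_1 eval_mult)

lemma eval_norm2_poly: "eval u (norm2_poly V) = norm2 V u"
  by (simp add: norm2_poly_def norm2_def eval_sum eval_power eval_Var)

lemmas eval_simps = eval_zero eval_1 eval_add eval_diff eval_uminus eval_mult eval_power
  eval_sum eval_Const eval_Var eval_norm2_poly

lemma continuous_on_eval:
  assumes "continuous_on S F"
  shows "continuous_on S (\<lambda>x. eval (F x) p)"
proof -
  have "continuous_on S (\<lambda>x. F x v)" for v
    using assms by (rule continuous_on_product_then_coordinatewise)
  then show ?thesis
    unfolding eval_def by (intro continuous_intros)
qed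

text \<open>Lets coordinates outside \<open>V\<close> be changed freely, for instance by
  \<open>proj\<close> or by an update at \<open>W\<close> or \<open>X0\<close>.\<close>

lemma eval_cong:
  assumes "p \<in> polys V" "\<And>v. v \<in> V \<Longrightarrow> u v = u' v"
  shows "eval u p = eval u' p"
  unfolding eval_def
proof (intro sum.cong refl arg_cong2[where f = "(*)"] prod.cong)
  fix a v assume "a \<in> Poly_Mapping.keys p" "v \<in> Poly_Mapping.keys a"
  then have "v \<in> V" using assms(1) by (auto simp: polys_def)
  then show "u v ^ Poly_Mapping.lookup a v = u' v ^ Poly_Mapping.lookup a v"
    using assms(2) by simp
qed

section \<open>Closure properties of the subring \<open>polys V\<close>\<close>

lemma polys_mono: "V \<subseteq> V' \<Longrightarrow> p \<in> polys V \<Longrightarrow> p \<in> polys V'"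
  by (auto simp: polys_def)

lemma polys_Const [simp]: "Const c \<in> polys V"
  by (simp add: polys_def Const_def)

lemma polys_0 [simp]: "0 \<in> polys V"
  by (simp add: polys_def)

lemma polys_1 [simp]: "1 \<in> polys V"
  by (simp add: polys_def)

lemma polys_Var [simp]: "Var v \<in> polys V \<longleftrightarrow> v \<in> V"
  by (simp add: polys_def Var_def)

lemma polys_add: "p \<in> polys V \<Longrightarrow> q \<in> polys V \<Longrightarrow> p + q \<in> polys V"
  using Poly_Mapping.keys_add[of p q] unfolding polys_def by blast

lemma polys_uminus: "p \<in> polys V \<Longrightarrow> - p \<in> polys V"
  by (simp add: polys_def)

lemma polys_diff: "p \<in> polys V \<Longrightarrow> q \<in> polys V \<Longrightarrow> p - q \<in> polys V"
  using polys_add[of p V "- q"] polys_uminus[of q V] by simp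

lemma polys_mult:
  assumes "p \<in> polys V" "q \<in> polys V"
  shows "p * q \<in> polys V"
  unfolding polys_def
proof clarify
  fix c v assume c: "c \<in> Poly_Mapping.keys (p * q)" and v: "v \<in> Poly_Mapping.keys c"
  obtain a b where ab: "a \<in> Poly_Mapping.keys p" "b \<in> Poly_Mapping.keys q" "c = a + b"
    using c Poly_Mapping.keys_mult[of p q] by blast
  with v Poly_Mapping.keys_add[of a b] have "v \<in> Poly_Mapping.keys a \<union> Poly_Mapping.keys b"
    by blast
  with ab assms show "v \<in> V" by (auto simp: polys_def)
qed

lemma polys_power: "p \<in> polys V \<Longrightarrow> p ^ n \<in> polys V"
  by (induction n) (auto intro: polys_mult)

lemma polys_sum: "(\<And>i. i \<in> I \<Longrightarrow> p i \<in> polys V) \<Longrightarrow> (\<Sum>i\<in>I. p i) \<in> polys V"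
  by (induction I rule: infinite_finite_induct) (auto intro: polys_add)

lemma polys_norm2_poly: "U \<subseteq> V \<Longrightarrow> norm2_poly U \<in> polys V"
  unfolding norm2_poly_def by (intro polys_sum polys_power) auto

lemmas polys_intros = polys_Const polys_0 polys_1 polys_add polys_uminus polys_diff polys_mult
  polys_power polys_sum polys_norm2_poly

section \<open>Degrees, induction over polynomials, homogeneity\<close>

lemma mono_degree_superset:
  assumes "finite A" "Poly_Mapping.keys a \<subseteq> A"
  shows "mono_degree a = (\<Sum>v\<in>A. Poly_Mapping.lookup a v)"
  unfolding mono_degree_def using assms
  by (intro sum.mono_neutral_left) (auto simp: in_keys_iff)

lemma mono_degree_add: "mono_degree (a + b) = mono_degree a + mono_degree b"
proof -
  let ?A = "Poly_Mapping.keys a \<union> Poly_Mapping.keys b"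
  have "Poly_Mapping.keys (a + b) \<subseteq> ?A" by (rule Poly_Mapping.keys_add)
  then show ?thesis
    by (simp add: mono_degree_superset[of ?A] lookup_add sum.distrib)
qed

lemma mono_degree_single: "mono_degree (Poly_Mapping.single v k) = k"
  by (simp add: mono_degree_def)

text \<open>A polynomial is the sum of its terms, and every nonconstant term is a variable times a
  term of smaller degree. The only product to be treated is the one with a single variable, which on
  the cube is bounded by 1.\<close>

lemma polys_induct [consumes 1, case_names Const add Var_mult]:
  assumes "p \<in> polys V"
    and C: "\<And>c. P (Const c)"
    and A: "\<And>p q. p \<in> polys V \<Longrightarrow> q \<in> polys V \<Longrightarrow> P p \<Longrightarrow> P q \<Longrightarrow> P (p + q)"
    and M: "\<And>v p. v \<in> V \<Longrightarrow> p \<in> polys V \<Longrightarrow> P p \<Longrightarrow> P (Var v * p)"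
  shows "P p"
proof -
  have single: "P (Poly_Mapping.single a c)" if "Poly_Mapping.keys a \<subseteq> V" for a c
    using that
  proof (induction "mono_degree a" arbitrary: a rule: less_induct)
    case less
    show ?case
    proof (cases "a = 0")
      case True
      then show ?thesis using C[of c] by (simp add: Const_def)
    next
      case False
      then obtain v where v: "v \<in> Poly_Mapping.keys a"
        by (metis keys_eq_empty ex_in_conv)
      \<comment> \<open>Truncated subtraction of exponents is exact here because \<open>v\<close>
        occurs in \<open>a\<close>.\<close>
      define b where "b = a - Poly_Mapping.single v 1"
      have lb: "Poly_Mapping.lookup b k = Poly_Mapping.lookup a k - (1 when v = k)" for k
        by (simp add: b_def lookup_minus lookup_single)
      have ab: "a = Poly_Mapping.single v 1 + b"
        using v by (intro poly_mapping_eqI) (auto simp: lookup_add lookup_single lb in_keys_iff when_def)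
      have kb: "Poly_Mapping.keys b \<subseteq> V"
        using less.prems by (auto simp: lb in_keys_iff)
      have "mono_degree b < mono_degree a"
        by (subst ab) (simp add: mono_degree_add mono_degree_single)
      then have "P (Poly_Mapping.single b c)" using less.hyps kb by blast
      moreover have "Poly_Mapping.single b c \<in> polys V" using kb by (auto simp: polys_def)
      moreover have "v \<in> V" using v less.prems by auto
      moreover have "Poly_Mapping.single a c = Var v * Poly_Mapping.single b c"
        by (subst ab) (simp add: Var_def mult_single)
      ultimately show ?thesis using M by simp
    qed
  qed
  \<comment> \<open>Membership in \<open>polys V\<close> is carried along because \<open>A\<close>
    demands it of both summands.\<close>
  have "(\<Sum>a\<in>A. Poly_Mapping.single a (Poly_Mapping.lookup p a)) \<in> polys V \<and>
      P (\<Sum>a\<in>A. Poly_Mapping.single a (Poly_Mapping.lookup p a))"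
    if "A \<subseteq> Poly_Mapping.keys p" for A
  proof -
    have "finite A" using that finite_subset[OF _ finite_keys] by blast
    then show ?thesis using that
    proof (induction A)
      case empty
      then show ?case using C[of 0] by (simp add: Const_0)
    next
      case (insert a A)
      then have "Poly_Mapping.keys a \<subseteq> V" using assms(1) by (auto simp: polys_def)
      then have "Poly_Mapping.single a (Poly_Mapping.lookup p a) \<in> polys V"
        "P (Poly_Mapping.single a (Poly_Mapping.lookup p a))"
        using single by (auto simp: polys_def)
      with insert show ?case by (auto intro: A polys_add)
    qed
  qed
  from this[of "Poly_Mapping.keys p"] show ?thesis
    using poly_mapping_eq_sum_single[of p] by simp
qed

text \<open>All monomials of the homogenization have degree \<open>total_degree p\<close>. In
  contrast to \<open>eval_homogenize\<close>, this also covers the points at infinity, where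
  \<open>x0\<close> vanishes.\<close>

lemma eval_scale_homogenize:
  "eval (\<lambda>v. c * u v) (homogenize x0 p) = c ^ total_degree p * eval u (homogenize x0 p)"
proof -
  have "(\<Prod>v\<in>Poly_Mapping.keys b. (c * u v) ^ Poly_Mapping.lookup b v) =
      c ^ mono_degree b * (\<Prod>v\<in>Poly_Mapping.keys b. u v ^ Poly_Mapping.lookup b v)" for b
    by (simp add: power_mult_distrib prod.distrib mono_degree_def power_sum)
  moreover have "mono_degree (a + Poly_Mapping.single x0 (total_degree p - mono_degree a)) =
      total_degree p" if "a \<in> Poly_Mapping.keys p" for a
  proof -
    have "mono_degree a \<le> total_degree p"
      using that by (auto simp: total_degree_def)
    then show ?thesis by (simp add: mono_degree_add mono_degree_single)
  qed
  ultimately show ?thesis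
    unfolding homogenize_def eval_sum eval_single sum_distrib_left
    by (intro sum.cong) simp_all
qed

lemma polys_homogenize:
  assumes "p \<in> polys V"
  shows "homogenize x0 p \<in> polys (insert x0 V)"
  unfolding homogenize_def
proof (rule polys_sum)
  fix a assume a: "a \<in> Poly_Mapping.keys p"
  let ?b = "Poly_Mapping.single x0 (total_degree p - mono_degree a)"
  have "Poly_Mapping.keys (a + ?b) \<subseteq> Poly_Mapping.keys a \<union> Poly_Mapping.keys ?b"
    by (rule Poly_Mapping.keys_add)
  also have "\<dots> \<subseteq> insert x0 V"
    using assms a by (auto simp: polys_def split: if_splits)
  finally show "Poly_Mapping.single (a + ?b) (Poly_Mapping.lookup p a) \<in> polys (insert x0 V)"
    by (auto simp: polys_def)
qed

section \<open>Approximation by polynomials and elimination of constraints\<close>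

definition cube :: "'v set \<Rightarrow> ('v \<Rightarrow> real) set" where
  "cube V = {u \<in> space_on V. \<forall>v. \<bar>u v\<bar> \<le> 1}"

text \<open>Tychonoff: the cube is a product of intervals \<open>{-1..1}\<close> over
  \<open>V\<close> and of singletons \<open>{0}\<close> elsewhere.\<close>

lemma compact_cube: "compact (cube V)"
proof -
  have "cube V = PiE UNIV (\<lambda>v. if v \<in> V then {-1..1} else {0})"
    by (force simp: cube_def space_on_def PiE_def Pi_def abs_le_iff)
  moreover have "compactin (product_topology (\<lambda>_. euclidean) UNIV)
      (PiE UNIV (\<lambda>v. if v \<in> V then {-1..1::real} else {0}))"
    by (subst compactin_PiE) auto
  ultimately show ?thesis
    by (simp add: euclidean_product_topology)
qed

text \<open>Stone-Weierstrass. Distinct points of \<open>space_on V\<close> differ at some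
  coordinate in \<open>V\<close>, so the variables separate the points of \<open>K\<close>.\<close>

lemma polys_dense:
  fixes K :: "('v::countable \<Rightarrow> real) set"
  assumes "compact K" "K \<subseteq> space_on V" "continuous_on K F" "0 < e"
  shows "\<exists>q\<in>polys V. \<forall>u\<in>K. \<bar>F u - eval u q\<bar> < e"
proof -
  interpret function_ring_on "{\<lambda>u. eval u q | q. q \<in> polys V}" K
  proof
    show "compact K" by fact
  next
    fix c show "(\<lambda>_. c) \<in> {\<lambda>u. eval u q | q. q \<in> polys V}"
      by (auto intro!: exI[of _ "Const c"] simp: eval_Const)
  next
    fix x y assume xy: "x \<in> K" "y \<in> K" "x \<noteq> y"
    then obtain v where v: "x v \<noteq> y v" by auto
    have "x \<in> space_on V" "y \<in> space_on V" using xy assms(2) by auto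
    with v have "v \<in> V" unfolding space_on_def by fastforce
    then have "(\<lambda>u. eval u (Var v)) \<in> {\<lambda>u. eval u q | q. q \<in> polys V}" by auto
    with v show "\<exists>f\<in>{\<lambda>u. eval u q | q. q \<in> polys V}. f x \<noteq> f y"
      by (intro bexI[rotated]) (simp_all add: eval_Var)
  next
    fix f1 f2 :: "('v \<Rightarrow> real) \<Rightarrow> real" assume "f1 \<in> {\<lambda>u. eval u q | q. q \<in> polys V}" "f2 \<in> {\<lambda>u. eval u q | q. q \<in> polys V}"
    then obtain q1 q2 where q: "q1 \<in> polys V" "q2 \<in> polys V" "f1 = (\<lambda>u. eval u q1)" "f2 = (\<lambda>u. eval u q2)"
      by blast
    show "(\<lambda>x. f1 x + f2 x) \<in> {\<lambda>u. eval u q | q. q \<in> polys V}"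
      using q by (auto intro!: exI[of _ "q1 + q2"] polys_add simp: eval_add)
    show "(\<lambda>x. f1 x * f2 x) \<in> {\<lambda>u. eval u q | q. q \<in> polys V}"
      using q by (auto intro!: exI[of _ "q1 * q2"] polys_mult simp: eval_mult)
  qed (auto intro!: continuous_on_eval continuous_on_id)
  show ?thesis
    using Stone_Weierstrass_basic[OF assms(3,4)] by blast
qed

lemma continuous_on_bounded_abs:
  fixes F :: "'a::topological_space \<Rightarrow> real"
  assumes "compact K" "continuous_on K F"
  obtains B where "0 < B" "\<And>u. u \<in> K \<Longrightarrow> \<bar>F u\<bar> \<le> B"
  using compact_imp_bounded[OF compact_continuous_image[OF assms(2,1)]]
  by (auto simp: bounded_pos)

text \<open>With \<open>M\<close> large, \<open>p - M max(0, -g) g\<close> is positive on all of \<open>K\<close>; the multiplier is then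
  replaced by the square of a polynomial approximation of its square root.\<close>

lemma eliminate_constraint:
  fixes K :: "('v::countable \<Rightarrow> real) set"
  assumes K: "compact K" "K \<subseteq> space_on V"
    and pos: "\<And>u. u \<in> K \<Longrightarrow> 0 \<le> eval u g \<Longrightarrow> 0 < eval u p"
  shows "\<exists>s\<in>polys V. \<forall>u\<in>K. 0 < eval u (p - s\<^sup>2 * g)"
proof (cases "K = {}")
  case True
  then show ?thesis by (intro bexI[of _ 0]) auto
next
  case False
  have c: "continuous_on S (\<lambda>u. eval u q)" for S :: "('v \<Rightarrow> real) set" and q
    by (intro continuous_on_eval continuous_on_id)
  \<comment> \<open>On this compact set \<open>g\<close> is negative, so the quotient of
    \<open>p\<close> by the square of \<open>g\<close> is bounded there.\<close>
  define D where "D = {u \<in> K. eval u p \<le> 0}"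
  have "D = K \<inter> {u. eval u p \<le> 0}" by (auto simp: D_def)
  then have "compact D"
    using K(1) by (auto intro!: compact_Int_closed closed_Collect_le c continuous_intros)
  moreover have gD: "eval u g < 0" if "u \<in> D" for u
    using that pos[of u] by (force simp: D_def)
  then have "continuous_on D (\<lambda>u. eval u p / (eval u g)\<^sup>2)"
    by (intro continuous_intros c) force
  ultimately obtain M where M: "0 < M" "\<And>u. u \<in> D \<Longrightarrow> \<bar>eval u p / (eval u g)\<^sup>2\<bar> \<le> M"
    by (rule continuous_on_bounded_abs) blast
  \<comment> \<open>The factor \<open>M + 1\<close> instead of \<open>M\<close> makes the inequality
    on \<open>D\<close> strict.\<close>
  define \<phi> where "\<phi> u = sqrt ((M + 1) * max 0 (- eval u g))" for u
  have \<phi>2: "(\<phi> u)\<^sup>2 = (M + 1) * max 0 (- eval u g)" for u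
    using M(1) by (simp add: \<phi>_def)
  have c\<phi>: "continuous_on K \<phi>"
    unfolding \<phi>_def by (intro continuous_intros c)
  have Fpos: "0 < eval u p - (\<phi> u)\<^sup>2 * eval u g" if u: "u \<in> K" for u
  proof (cases "0 \<le> eval u g")
    case True
    then show ?thesis using pos[OF u] by (simp add: \<phi>2)
  next
    case neg: False
    then have eq: "eval u p - (\<phi> u)\<^sup>2 * eval u g = eval u p + (M + 1) * (eval u g)\<^sup>2"
      unfolding \<phi>2 by (simp add: power2_eq_square)
    have g2: "0 < (eval u g)\<^sup>2" using neg by simp
    show ?thesis
    proof (cases "eval u p \<le> 0")
      case True
      then have "\<bar>eval u p / (eval u g)\<^sup>2\<bar> < M + 1" using M(2)[of u] u by (simp add: D_def)
      then have "- eval u p < (M + 1) * (eval u g)\<^sup>2"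
        using g2 True by (simp add: abs_div field_simps)
      then show ?thesis using eq by simp
    next
      case False
      then show ?thesis unfolding eq using g2 M(1) by (intro add_pos_pos mult_pos_pos) auto
    qed
  qed
  have "continuous_on K (\<lambda>u. eval u p - (\<phi> u)\<^sup>2 * eval u g)"
    by (intro continuous_intros c c\<phi>)
  from continuous_attains_inf[OF K(1) False this] Fpos
  obtain m where m: "0 < m" "\<And>u. u \<in> K \<Longrightarrow> m \<le> eval u p - (\<phi> u)\<^sup>2 * eval u g"
    by (metis (no_types, lifting))
  obtain B where B: "0 < B" "\<And>u. u \<in> K \<Longrightarrow> \<bar>\<phi> u\<bar> \<le> B"
    using continuous_on_bounded_abs[OF K(1) c\<phi>] by blast
  obtain G where G: "0 < G" "\<And>u. u \<in> K \<Longrightarrow> \<bar>eval u g\<bar> \<le> G"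
    using continuous_on_bounded_abs[OF K(1) c[of K g]] by blast
  \<comment> \<open>Replacing \<open>\<phi>\<close> by \<open>s\<close> changes the value by
    \<open>(\<phi> - s) * (\<phi> + s) * g\<close>, which is at most
    \<open>e * (2 * B + 1) * G\<close>; the bound \<open>e \<le> 1\<close> is what gives
    \<open>2 * B + 1\<close>. The choice keeps this below the minimum \<open>m\<close>.\<close>
  define e where "e = min 1 (m / (2 * ((2 * B + 1) * G)))"
  have e: "0 < e" "e \<le> 1" "e * (2 * B + 1) * G < m"
  proof -
    show "0 < e" "e \<le> 1" using m B G by (auto simp: e_def)
    have D: "0 < (2 * B + 1) * G" using B G by simp
    have "e \<le> m / (2 * ((2 * B + 1) * G))" unfolding e_def by (rule min.cobounded2)
    then have "e * ((2 * B + 1) * G) \<le> m / 2" using D by (simp add: field_simps)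
    then show "e * (2 * B + 1) * G < m" using m by (simp add: mult.assoc)
  qed
  obtain s where s: "s \<in> polys V" "\<And>u. u \<in> K \<Longrightarrow> \<bar>\<phi> u - eval u s\<bar> < e"
    using polys_dense[OF K c\<phi> e(1)] by blast
  have "0 < eval u (p - s\<^sup>2 * g)" if u: "u \<in> K" for u
  proof -
    have "\<bar>\<phi> u + eval u s\<bar> \<le> 2 * B + 1"
      using s(2)[OF u] B(2)[OF u] e(2) by linarith
    then have "\<bar>(\<phi> u - eval u s) * (\<phi> u + eval u s) * eval u g\<bar> \<le> e * (2 * B + 1) * G"
      unfolding abs_mult using s(2)[OF u] G(2)[OF u] e(1) B(1)
      by (intro mult_mono) auto
    moreover have "(\<phi> u - eval u s) * (\<phi> u + eval u s) * eval u g =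
        (\<phi> u)\<^sup>2 * eval u g - (eval u s)\<^sup>2 * eval u g"
      by (simp add: power2_eq_square algebra_simps)
    ultimately show ?thesis
      using m(2)[OF u] e(3) by (simp add: eval_simps)
  qed
  then show ?thesis using s(1) by blast
qed

text \<open>The constraint \<open>g i\<close> is removed on the compact set \<open>K'\<close> where
  the others hold. The resulting difference satisfies the hypothesis for the smaller index set,
  which is why \<open>p\<close> varies in the induction.\<close>

lemma eliminate_constraints:
  fixes K :: "('v::countable \<Rightarrow> real) set"
  assumes "finite I" and K: "compact K" "K \<subseteq> space_on V"
    and pos: "\<And>u. u \<in> K \<Longrightarrow> (\<And>i. i \<in> I \<Longrightarrow> 0 \<le> eval u (g i)) \<Longrightarrow> 0 < eval u p"
  shows "\<exists>s. (\<forall>i\<in>I. s i \<in> polys V) \<and> (\<forall>u\<in>K. 0 < eval u (p - (\<Sum>i\<in>I. (s i)\<^sup>2 * g i)))"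
  using assms(1) pos
proof (induction I arbitrary: p)
  case empty
  then show ?case by simp
next
  case (insert i I)
  define K' where "K' = K \<inter> (\<Inter>j\<in>I. {u. 0 \<le> eval u (g j)})"
  have "compact K'"
    unfolding K'_def using K(1)
    by (auto intro!: compact_Int_closed closed_INT closed_Collect_le continuous_intros
        continuous_on_eval)
  moreover have "K' \<subseteq> space_on V" using K(2) by (auto simp: K'_def)
  moreover have "0 < eval u p" if "u \<in> K'" "0 \<le> eval u (g i)" for u
    using that by (intro insert.prems) (auto simp: K'_def)
  ultimately obtain t where t: "t \<in> polys V" "\<forall>u\<in>K'. 0 < eval u (p - t\<^sup>2 * g i)"
    using eliminate_constraint by metis
  have "0 < eval u (p - t\<^sup>2 * g i)" if "u \<in> K" "\<And>j. j \<in> I \<Longrightarrow> 0 \<le> eval u (g j)" for u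
    using that t(2) by (auto simp: K'_def)
  from insert.IH[OF this] obtain s where
    s: "\<forall>j\<in>I. s j \<in> polys V" "\<forall>u\<in>K. 0 < eval u (p - t\<^sup>2 * g i - (\<Sum>j\<in>I. (s j)\<^sup>2 * g j))"
    by blast
  have "(\<Sum>j\<in>insert i I. ((s(i := t)) j)\<^sup>2 * g j) = t\<^sup>2 * g i + (\<Sum>j\<in>I. (s j)\<^sup>2 * g j)"
    using insert.hyps by (auto intro!: sum.cong)
  then show ?case
    using s t(1) by (intro exI[of _ "s(i := t)"]) (simp add: diff_diff_eq)
qed

section \<open>Positivity on the cube\<close>

lemma Const_nonneg_square: "0 \<le> c \<Longrightarrow> Const c = (Const (sqrt c))\<^sup>2"
  by (simp add: Const_power[symmetric])

text \<open>The last two assumptions are the algebraic counterpart of lying in the cube. Closure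
  under products is what allows inequalities modulo \<open>T\<close> to be multiplied by
  \<open>1 \<plusminus> Var v\<close>.\<close>

locale cube_preordering =
  fixes V :: "'v::countable set" and T :: "'v mpoly set"
  assumes finV: "finite V"
    and T_add: "p \<in> T \<Longrightarrow> q \<in> T \<Longrightarrow> p + q \<in> T"
    and T_mult: "p \<in> T \<Longrightarrow> q \<in> T \<Longrightarrow> p * q \<in> T"
    and T_square: "p \<in> polys V \<Longrightarrow> p\<^sup>2 \<in> T"
    and bounded_above: "v \<in> V \<Longrightarrow> 1 - Var v \<in> T"
    and bounded_below: "v \<in> V \<Longrightarrow> 1 + Var v \<in> T"
begin

lemma nonneg_Const: "0 \<le> c \<Longrightarrow> Const c \<in> T"
  by (subst Const_nonneg_square) (auto intro: T_square)

lemma T_sum: "finite I \<Longrightarrow> (\<And>i. i \<in> I \<Longrightarrow> p i \<in> T) \<Longrightarrow> (\<Sum>i\<in>I. p i) \<in> T"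
  by (induction I rule: finite_induct) (use nonneg_Const[of 0] in \<open>auto intro: T_add simp: Const_0\<close>)

definition dist2_poly :: "('v \<Rightarrow> real) \<Rightarrow> 'v mpoly" where
  "dist2_poly a = (\<Sum>v\<in>V. (Var v - Const (a v))\<^sup>2)"

lemma half: "p + p \<in> T \<Longrightarrow> p \<in> T"
proof -
  assume "p + p \<in> T"
  then have "Const (1/2) * (p + p) \<in> T" by (intro T_mult nonneg_Const) auto
  moreover have "Const (1/2) * (p + p) = Const (1/2 + 1/2) * p"
    unfolding Const_add by (simp add: algebra_simps)
  ultimately show ?thesis by (simp add: Const_1)
qed

text \<open>Completing the square: with \<open>t = Var v - Const (a v)\<close>, the polynomial
  \<open>\<eta> + k t + k^2 / (4 \<eta>) t^2\<close> is the square of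
  \<open>sqrt \<eta> + k / (2 sqrt \<eta>) t\<close>. The weight of the distance involves only the
  bound \<open>C\<close>, so that it is the same for all admissible \<open>k\<close>.\<close>

lemma linear_lower_bound:
  assumes v: "v \<in> V" and "0 < \<eta>" "\<bar>k\<bar> \<le> C"
  shows "Const k * (Var v - Const (a v)) + Const \<eta> + Const (C\<^sup>2 / (4 * \<eta>)) * dist2_poly a \<in> T"
proof -
  define t where "t = Var v - Const (a v)"
  have tp: "t \<in> polys V" using v by (auto simp: t_def intro!: polys_intros)
  have "(Const (sqrt \<eta>) + Const (k / (2 * sqrt \<eta>)) * t)\<^sup>2 \<in> T"
    using tp by (intro T_square polys_intros)
  moreover have "(Const (sqrt \<eta>) + Const (k / (2 * sqrt \<eta>)) * t)\<^sup>2
      = Const \<eta> + Const k * t + Const (k\<^sup>2 / (4 * \<eta>)) * t\<^sup>2"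
  proof -
    define A B :: "'v mpoly" where "A = Const (sqrt \<eta>)" and "B = Const (k / (2 * sqrt \<eta>))"
    have eqs: "Const \<eta> = A * A" "Const k = A * B + A * B" "Const (k\<^sup>2 / (4 * \<eta>)) = B * B"
      using assms(2) unfolding A_def B_def
      by (simp_all add: power_divide power_mult_distrib
          flip: Const_mult Const_add Const_power power2_eq_square)
    show ?thesis
      unfolding A_def[symmetric] B_def[symmetric] eqs by (simp add: power2_eq_square algebra_simps)
  qed
  moreover have "Const (C\<^sup>2 / (4 * \<eta>) - k\<^sup>2 / (4 * \<eta>)) * t\<^sup>2 \<in> T"
  proof (intro T_mult nonneg_Const T_square tp)
    have "k\<^sup>2 \<le> C\<^sup>2" using assms(3) by (metis abs_ge_zero power2_abs power_mono)
    then show "0 \<le> C\<^sup>2 / (4 * \<eta>) - k\<^sup>2 / (4 * \<eta>)"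
      using assms(2) by (simp add: divide_right_mono)
  qed
  moreover have "Const (C\<^sup>2 / (4 * \<eta>)) * (\<Sum>w\<in>V - {v}. (Var w - Const (a w))\<^sup>2) \<in> T"
    using assms(2) finV by (intro T_mult nonneg_Const T_sum T_square polys_intros) auto
  ultimately have "(Const \<eta> + Const k * t + Const (k\<^sup>2 / (4 * \<eta>)) * t\<^sup>2) +
      (Const (C\<^sup>2 / (4 * \<eta>) - k\<^sup>2 / (4 * \<eta>)) * t\<^sup>2 +
       Const (C\<^sup>2 / (4 * \<eta>)) * (\<Sum>w\<in>V - {v}. (Var w - Const (a w))\<^sup>2)) \<in> T"
    by (intro T_add[OF _ T_add]) simp_all
  moreover have "dist2_poly a = t\<^sup>2 + (\<Sum>w\<in>V - {v}. (Var w - Const (a w))\<^sup>2)"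
    unfolding dist2_poly_def t_def using finV v by (rule sum.remove)
  ultimately show ?thesis
    unfolding t_def[symmetric] by (simp add: Const_diff algebra_simps)
qed

text \<open>An algebraic form of uniform continuity on the cube.\<close>

lemma quadratic_lower_bound:
  assumes "q \<in> polys V" "0 < \<eta>"
  shows "\<exists>\<kappa>\<ge>0. \<forall>a\<in>cube V.
    q - Const (eval a q) + Const \<eta> + Const \<kappa> * dist2_poly a \<in> T \<and>
    Const (eval a q) - q + Const \<eta> + Const \<kappa> * dist2_poly a \<in> T"
  using assms
proof (induction q arbitrary: \<eta> rule: polys_induct)
  case (Const c)
  then show ?case
    by (intro exI[of _ 0]) (auto simp: eval_Const Const_0 intro: nonneg_Const)
next
  case (add p q)
  have "0 < \<eta> / 2" using add.prems by simp
  obtain \<kappa> where \<kappa>: "\<kappa> \<ge> 0" "\<And>a. a \<in> cube V \<Longrightarrow>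
      p - Const (eval a p) + Const (\<eta>/2) + Const \<kappa> * dist2_poly a \<in> T \<and>
      Const (eval a p) - p + Const (\<eta>/2) + Const \<kappa> * dist2_poly a \<in> T"
    using add.IH(1)[OF \<open>0 < \<eta> / 2\<close>] by blast
  obtain \<mu> where \<mu>: "\<mu> \<ge> 0" "\<And>a. a \<in> cube V \<Longrightarrow>
      q - Const (eval a q) + Const (\<eta>/2) + Const \<mu> * dist2_poly a \<in> T \<and>
      Const (eval a q) - q + Const (\<eta>/2) + Const \<mu> * dist2_poly a \<in> T"
    using add.IH(2)[OF \<open>0 < \<eta> / 2\<close>] by blast
  have \<eta>: "Const \<eta> = Const (\<eta>/2) + Const (\<eta>/2)"
    by (simp flip: Const_add)
  show ?case
  proof (intro exI[of _ "\<kappa> + \<mu>"] conjI ballI)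
    show "0 \<le> \<kappa> + \<mu>" using \<kappa> \<mu> by simp
    fix a assume a: "a \<in> cube V"
    note 1 = \<kappa>(2)[OF a, THEN conjunct1] \<mu>(2)[OF a, THEN conjunct1]
    note 2 = \<kappa>(2)[OF a, THEN conjunct2] \<mu>(2)[OF a, THEN conjunct2]
    show "p + q - Const (eval a (p + q)) + Const \<eta> + Const (\<kappa> + \<mu>) * dist2_poly a \<in> T"
      using T_add[OF 1] unfolding \<eta> by (simp add: eval_add Const_add algebra_simps)
    show "Const (eval a (p + q)) - (p + q) + Const \<eta> + Const (\<kappa> + \<mu>) * dist2_poly a \<in> T"
      using T_add[OF 2] unfolding \<eta> by (simp add: eval_add Const_add algebra_simps)
  qed
next
  case (Var_mult v p)
  have "0 < \<eta> / 2" using Var_mult.prems by simp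
  obtain \<kappa> where \<kappa>: "\<kappa> \<ge> 0" "\<And>a. a \<in> cube V \<Longrightarrow>
      p - Const (eval a p) + Const (\<eta>/2) + Const \<kappa> * dist2_poly a \<in> T \<and>
      Const (eval a p) - p + Const (\<eta>/2) + Const \<kappa> * dist2_poly a \<in> T"
    using Var_mult.IH[OF \<open>0 < \<eta> / 2\<close>] by blast
  \<comment> \<open>A bound uniform over the cube keeps the final constant
    \<open>\<kappa> + \<mu>\<close> independent of \<open>a\<close>.\<close>
  obtain C where C: "\<And>a. a \<in> cube V \<Longrightarrow> \<bar>eval a p\<bar> \<le> C"
    using continuous_on_bounded_abs[OF compact_cube continuous_on_eval[OF continuous_on_id]]
    by metis
  define \<mu> where "\<mu> = C\<^sup>2 / (4 * (\<eta>/2))"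
  have "0 \<le> \<mu>" using Var_mult.prems by (simp add: \<mu>_def)
  have \<eta>: "Const \<eta> = Const (\<eta>/2) + Const (\<eta>/2)"
    by (simp flip: Const_add)
  show ?case
  proof (intro exI[of _ "\<kappa> + \<mu>"] conjI ballI)
    show "0 \<le> \<kappa> + \<mu>" using \<kappa> \<open>0 \<le> \<mu>\<close> by simp
    fix a assume a: "a \<in> cube V"
    \<comment> \<open>The error splits as \<open>Var v * p - a v * eval a p = Var v * d + eval a p *
      (Var v - a v)\<close>. The first summand is controlled by the induction hypothesis, the second
      by \<open>linear_lower_bound\<close>.\<close>
    define d where "d = p - Const (eval a p)"
    define E where "E = Const (\<eta>/2) + Const \<kappa> * dist2_poly a"
    have d1: "d + E \<in> T" and d2: "E - d \<in> T"
      using \<kappa>(2)[OF a] by (auto simp: d_def E_def algebra_simps)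
    note u = bounded_above[OF Var_mult.hyps(1)] bounded_below[OF Var_mult.hyps(1)]
    \<comment> \<open>Algebraic form of \<open>|Var v * d| \<le> E\<close>, from
      \<open>|d| \<le> E\<close> and \<open>|Var v| \<le> 1\<close>: this sum is twice
      \<open>Var v * d + E\<close>, and with the two factors exchanged it is twice
      \<open>E - Var v * d\<close>.\<close>
    have "(1 + Var v) * (d + E) + (1 - Var v) * (E - d) \<in> T"
      by (intro T_add[OF T_mult[OF _ d1] T_mult[OF _ d2]] u)
    then have "(Var v * d + E) + (Var v * d + E) \<in> T"
      by (simp add: algebra_simps)
    then have 1: "Var v * d + E \<in> T"
      by (rule half)
    have "(1 - Var v) * (d + E) + (1 + Var v) * (E - d) \<in> T"
      by (intro T_add[OF T_mult[OF _ d1] T_mult[OF _ d2]] u)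
    then have "(E - Var v * d) + (E - Var v * d) \<in> T"
      by (simp add: algebra_simps)
    then have 2: "E - Var v * d \<in> T"
      by (rule half)
    have "\<bar>eval a p\<bar> \<le> C" "\<bar>- eval a p\<bar> \<le> C" using C[OF a] by auto
    note lin = this[THEN linear_lower_bound[OF Var_mult.hyps(1) \<open>0 < \<eta> / 2\<close>], of a,
        folded \<mu>_def]
    show "Var v * p - Const (eval a (Var v * p)) + Const \<eta> + Const (\<kappa> + \<mu>) * dist2_poly a \<in> T"
      using T_add[OF 1 lin(1)] unfolding \<eta> d_def E_def
      by (simp add: eval_mult eval_Var Const_add Const_mult algebra_simps)
    show "Const (eval a (Var v * p)) - Var v * p + Const \<eta> + Const (\<kappa> + \<mu>) * dist2_poly a \<in> T"
      using T_add[OF 2 lin(2)] unfolding \<eta> d_def E_def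
      by (simp add: eval_mult eval_Var Const_add Const_mult Const_uminus algebra_simps)
  qed
qed

text \<open>The \<open>j\<close>-th element is the conditional expectation, given that the first \<open>j\<close> of \<open>N\<close>
  independent signs of mean \<open>Var v\<close> add up to \<open>s\<close>, of \<open>q + \<kappa> (Var v - a)\<^sup>2\<close>, where \<open>a\<close> is the
  average of all signs. Averaging over the next sign multiplies by \<open>(1 \<plusminus> Var v) / 2\<close>, which
  stays in \<open>T\<close>; at \<open>j = 0\<close> only the variance \<open>(1 - (Var v)\<^sup>2) / N\<close> is left.\<close>

lemma remove_square_random_walk:
  assumes v: "v \<in> V" and N: "0 < N" and "0 \<le> \<kappa>"
    and q: "\<And>a. \<bar>a\<bar> \<le> 1 \<Longrightarrow> q + Const \<kappa> * (Var v - Const a)\<^sup>2 \<in> T"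
    and "j \<le> N" "\<bar>s\<bar> \<le> real j"
  shows "q + Const (\<kappa> / (real N)\<^sup>2) *
      ((Const (real j) * Var v - Const s)\<^sup>2 + Const (real (N - j)) * (1 - (Var v)\<^sup>2)) \<in> T"
  using assms(5,6)
proof (induction j arbitrary: s rule: inc_induct)
  case base
  \<comment> \<open>Once all \<open>N\<close> signs are known, their average is a fixed number in
    the interval, and the hypothesis applies to it.\<close>
  have "\<bar>s / real N\<bar> \<le> 1" using base N by (simp add: field_simps)
  note q[OF this]
  moreover have "Const (\<kappa> / (real N)\<^sup>2) * (Const (real N) * Var v - Const s)\<^sup>2 =
      Const \<kappa> * (Var v - Const (s / real N))\<^sup>2"
  proof -
    have s: "Const s = Const (real N) * Const (s / real N)" and
      l: "Const \<kappa> = Const (\<kappa> / (real N)\<^sup>2) * (Const (real N))\<^sup>2"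
      using N by (auto simp: Const_mult[symmetric] Const_power[symmetric])
    show ?thesis
      by (subst s, subst l) (simp add: power2_eq_square algebra_simps)
  qed
  ultimately show ?case by (simp add: Const_0)
next
  case (step j)
  define c where "c = (Const (\<kappa> / (real N)\<^sup>2) :: 'v mpoly)"
  define J where "J = (Const (real j) :: 'v mpoly)"
  define S where "S = (Const s :: 'v mpoly)"
  define L where "L = (Const (real (N - Suc j)) :: 'v mpoly)"
  define u where "u = Var v"
  have eqs: "Const (real (Suc j)) = J + 1" "Const (s + 1) = S + 1" "Const (s - 1) = S - 1"
    "Const (real (N - j)) = L + 1"
    using step.hyps by (simp_all add: J_def S_def L_def of_nat_diff Const_add Const_diff Const_1)
  have 1: "q + c * (((J + 1) * u - (S + 1))\<^sup>2 + L * (1 - u\<^sup>2)) \<in> T"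
    using step.IH[of "s + 1"] step.prems unfolding eqs c_def[symmetric] u_def[symmetric] L_def[symmetric]
    by simp
  have 2: "q + c * (((J + 1) * u - (S - 1))\<^sup>2 + L * (1 - u\<^sup>2)) \<in> T"
    using step.IH[of "s - 1"] step.prems unfolding eqs c_def[symmetric] u_def[symmetric] L_def[symmetric]
    by simp
  have "(1 + u) * (q + c * (((J + 1) * u - (S + 1))\<^sup>2 + L * (1 - u\<^sup>2))) +
        (1 - u) * (q + c * (((J + 1) * u - (S - 1))\<^sup>2 + L * (1 - u\<^sup>2))) \<in> T"
    using bounded_above[OF v] bounded_below[OF v] unfolding u_def[symmetric]
    by (intro T_add[OF T_mult[OF _ 1] T_mult[OF _ 2]])
  \<comment> \<open>The increment, \<open>u\<close> minus a sign of mean \<open>u\<close>, has mean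
    zero and variance \<open>1 - u^2\<close>. Hence the cross terms cancel and the coefficient
    \<open>L\<close> grows to \<open>L + 1\<close>.\<close>
  also have "(1 + u) * (q + c * (((J + 1) * u - (S + 1))\<^sup>2 + L * (1 - u\<^sup>2))) +
        (1 - u) * (q + c * (((J + 1) * u - (S - 1))\<^sup>2 + L * (1 - u\<^sup>2))) =
      (q + c * ((J * u - S)\<^sup>2 + (L + 1) * (1 - u\<^sup>2))) +
      (q + c * ((J * u - S)\<^sup>2 + (L + 1) * (1 - u\<^sup>2)))"
    by (simp add: power2_eq_square algebra_simps)
  finally show ?case
    unfolding eqs c_def[symmetric] u_def[symmetric] J_def[symmetric] S_def[symmetric]
    by (rule half)
qed

text \<open>The start of the walk, \<open>j = 0\<close> and \<open>s = 0\<close>, leaves the error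
  \<open>\<kappa> / N * (1 - (Var v)^2)\<close>. Once \<open>\<kappa> / N < \<delta>\<close>, it is
  absorbed by adding a multiple of a square and a nonnegative constant.\<close>

lemma remove_square:
  assumes v: "v \<in> V" and "0 \<le> \<kappa>" "0 < \<delta>"
    and q: "\<And>a. \<bar>a\<bar> \<le> 1 \<Longrightarrow> q + Const \<kappa> * (Var v - Const a)\<^sup>2 \<in> T"
  shows "q + Const \<delta> \<in> T"
proof -
  obtain N :: nat where N: "\<kappa> / \<delta> < real N" using reals_Archimedean2 by blast
  have "0 \<le> \<kappa> / \<delta>" using assms by simp
  with N have N0: "0 < N" by (cases N) auto
  have "q + Const (\<kappa> / (real N)\<^sup>2) * (Const (real N) * (1 - (Var v)\<^sup>2)) \<in> T"
    using remove_square_random_walk[OF v N0 assms(2) q, of 0 0] by (simp add: Const_0)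
  moreover have "Const (\<kappa> / (real N)\<^sup>2) * Const (real N) = (Const (\<kappa> / real N) :: 'v mpoly)"
    using N0 by (simp add: Const_mult[symmetric] power2_eq_square)
  ultimately have 1: "q + Const (\<kappa> / real N) * (1 - (Var v)\<^sup>2) \<in> T"
    by (simp add: mult.assoc[symmetric])
  have "Const (\<kappa> / real N) * (Var v)\<^sup>2 + Const (\<delta> - \<kappa> / real N) \<in> T"
    using v assms N N0 by (intro T_add T_mult T_square nonneg_Const) (auto simp: field_simps)
  from T_add[OF 1 this] show ?thesis
    by (simp add: Const_diff algebra_simps)
qed

text \<open>One variable at a time, half of the slack for each: with the coordinate \<open>b\<close>
  of the new variable held fixed, the induction hypothesis removes the other squares, and
  \<open>remove_square\<close> then removes the last one.\<close>

lemma remove_squares: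
  assumes "finite U" "U \<subseteq> V" "0 \<le> \<kappa>" "0 < \<delta>"
    and "\<And>a. (\<And>v. v \<in> U \<Longrightarrow> \<bar>a v\<bar> \<le> 1) \<Longrightarrow>
      q + Const \<kappa> * (\<Sum>v\<in>U. (Var v - Const (a v))\<^sup>2) \<in> T"
  shows "q + Const \<delta> \<in> T"
  using assms(1,2,4,5)
proof (induction U arbitrary: q \<delta>)
  case empty
  then show ?case using T_add[OF _ nonneg_Const[of \<delta>], of q] by simp
next
  case (insert v U)
  have "(q + Const (\<delta>/2)) + Const \<kappa> * (Var v - Const b)\<^sup>2 \<in> T" if b: "\<bar>b\<bar> \<le> 1" for b
  proof -
    have "q + Const \<kappa> * (Var v - Const b)\<^sup>2 + Const (\<delta>/2) \<in> T"
    proof (rule insert.IH)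
      show "U \<subseteq> V" "0 < \<delta>/2" using insert.prems by auto
      fix a :: "'v \<Rightarrow> real" assume a: "\<And>v. v \<in> U \<Longrightarrow> \<bar>a v\<bar> \<le> 1"
      have "(\<Sum>w\<in>insert v U. (Var w - Const ((a(v := b)) w))\<^sup>2) =
          (Var v - Const b)\<^sup>2 + (\<Sum>w\<in>U. (Var w - Const (a w))\<^sup>2)"
        using insert.hyps by (auto intro!: sum.cong)
      moreover have "q + Const \<kappa> * (\<Sum>w\<in>insert v U. (Var w - Const ((a(v := b)) w))\<^sup>2) \<in> T"
        using a b by (intro insert.prems(3)) auto
      ultimately show "q + Const \<kappa> * (Var v - Const b)\<^sup>2 +
          Const \<kappa> * (\<Sum>w\<in>U. (Var w - Const (a w))\<^sup>2) \<in> T"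
        by (simp add: algebra_simps)
    qed
    then show ?thesis by (simp add: algebra_simps)
  qed
  then have "q + Const (\<delta>/2) + Const (\<delta>/2) \<in> T"
    using insert.prems assms(3) by (intro remove_square[of v \<kappa>]) auto
  then show ?case
    by (simp add: add.assoc flip: Const_add)
qed

text \<open>With \<open>c\<close> a positive lower bound of \<open>q\<close>,
  \<open>quadratic_lower_bound\<close> with error \<open>c/2\<close> shows that modulo
  \<open>T\<close> the polynomial \<open>q - c/2\<close> is at least \<open>- \<kappa>\<close> times
  the squared distance to \<open>a\<close>, for every \<open>a\<close> in the cube. Removing the
  squares costs the other \<open>c/2\<close>.\<close>

lemma positive_on_cube:
  assumes q: "q \<in> polys V" and pos: "\<And>u. u \<in> cube V \<Longrightarrow> 0 < eval u q"
  shows "q \<in> T"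
proof -
  have "(\<lambda>_. 0) \<in> cube V" by (simp add: cube_def space_on_def)
  then have "cube V \<noteq> {}" by blast
  from continuous_attains_inf[OF compact_cube this continuous_on_eval[OF continuous_on_id]] pos
  obtain c where c: "0 < c" "\<And>u. u \<in> cube V \<Longrightarrow> c \<le> eval u q"
    by metis
  have c2: "0 < c / 2" using c by simp
  obtain \<kappa> where \<kappa>: "0 \<le> \<kappa>" "\<And>a. a \<in> cube V \<Longrightarrow>
      q - Const (eval a q) + Const (c/2) + Const \<kappa> * dist2_poly a \<in> T"
    using quadratic_lower_bound[OF q c2] by blast
  have "(q - Const (c/2)) + Const (c/2) \<in> T"
  proof (rule remove_squares[OF finV order.refl \<kappa>(1) c2])
    fix a :: "'v \<Rightarrow> real" assume a: "\<And>v. v \<in> V \<Longrightarrow> \<bar>a v\<bar> \<le> 1"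
    \<comment> \<open>\<open>remove_squares\<close> bounds \<open>a\<close> only on
      \<open>V\<close>; the projection makes it a point of the cube.\<close>
    define b where "b = proj V a"
    have b: "b \<in> cube V" using a by (auto simp: b_def proj_def cube_def space_on_def)
    have "dist2_poly b = (\<Sum>v\<in>V. (Var v - Const (a v))\<^sup>2)"
      unfolding dist2_poly_def b_def proj_def by (intro sum.cong) auto
    with \<kappa>(2)[OF b] have
      "q - Const (eval b q) + Const (c/2) + Const \<kappa> * (\<Sum>v\<in>V. (Var v - Const (a v))\<^sup>2) \<in> T"
      by simp
    moreover have "Const (eval b q - c) \<in> T" using c(2)[OF b] by (intro nonneg_Const) simp
    ultimately have "(q - Const (eval b q) + Const (c/2) +
        Const \<kappa> * (\<Sum>v\<in>V. (Var v - Const (a v))\<^sup>2)) + Const (eval b q - c) \<in> T"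
      by (rule T_add)
    moreover have "Const c = Const (c/2) + (Const (c/2) :: 'v mpoly)"
      by (simp flip: Const_add)
    ultimately show "q - Const (c/2) + Const \<kappa> * (\<Sum>v\<in>V. (Var v - Const (a v))\<^sup>2) \<in> T"
      by (simp add: Const_diff algebra_simps)
  qed
  then show ?thesis by simp
qed

end

section \<open>Putinar's theorem on the unit sphere\<close>

lemma sos_0: "0 \<in> sos V"
  by (auto simp: sos_def intro!: exI[of _ "[]"])

lemma sos_square: "p \<in> polys V \<Longrightarrow> p\<^sup>2 \<in> sos V"
  by (auto simp: sos_def intro!: exI[of _ "[p]"])

lemma sos_add:
  assumes "p \<in> sos V" "q \<in> sos V"
  shows "p + q \<in> sos V"
proof -
  obtain ps qs where "p = (\<Sum>r\<leftarrow>ps. r\<^sup>2)" "set ps \<subseteq> polys V" "q = (\<Sum>r\<leftarrow>qs. r\<^sup>2)" "set qs \<subseteq> polys V"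
    using assms by (auto simp: sos_def)
  then show ?thesis
    by (auto simp: sos_def intro!: exI[of _ "ps @ qs"])
qed

lemma sos_induct [consumes 1, case_names zero add]:
  assumes "p \<in> sos V" "P 0"
    and step: "\<And>p q. p \<in> polys V \<Longrightarrow> q \<in> sos V \<Longrightarrow> P q \<Longrightarrow> P (p\<^sup>2 + q)"
  shows "P p"
proof -
  obtain qs where qs: "p = (\<Sum>q\<leftarrow>qs. q\<^sup>2)" "set qs \<subseteq> polys V"
    using assms(1) by (auto simp: sos_def)
  have "P (\<Sum>q\<leftarrow>qs. q\<^sup>2)" using qs(2)
  proof (induction qs)
    case (Cons q qs)
    then show ?case by (auto intro!: step simp: sos_def)
  qed (simp add: assms(2))
  with qs show ?thesis by simp
qed

lemma sos_in_polys: "p \<in> sos V \<Longrightarrow> p \<in> polys V"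
  by (induction rule: sos_induct) (auto intro!: polys_intros)

lemma sos_square_mult: "q \<in> sos V \<Longrightarrow> p \<in> polys V \<Longrightarrow> p\<^sup>2 * q \<in> sos V"
  by (induction rule: sos_induct)
     (auto simp: distrib_left power_mult_distrib[symmetric] intro!: sos_add sos_square sos_0 polys_mult)

lemma sos_mult: "p \<in> sos V \<Longrightarrow> q \<in> sos V \<Longrightarrow> p * q \<in> sos V"
  by (induction rule: sos_induct)
     (auto simp: distrib_right intro!: sos_add sos_square_mult sos_0)

lemma sos_sum: "finite I \<Longrightarrow> (\<And>i. i \<in> I \<Longrightarrow> p i \<in> sos V) \<Longrightarrow> (\<Sum>i\<in>I. p i) \<in> sos V"
  by (induction I rule: finite_induct) (auto intro: sos_add sos_0)

text \<open>Sums of squares modulo the ideal of the unit sphere. Products only add further multiples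
  of the sphere equation, so this quadratic module is already a preordering.\<close>

definition sphere_preorder :: "'v set \<Rightarrow> 'v mpoly set" where
  "sphere_preorder V = {\<sigma> + r * (norm2_poly V - 1) | \<sigma> r. \<sigma> \<in> sos V \<and> r \<in> polys V}"

lemma sphere_preorderI:
  "\<sigma> \<in> sos V \<Longrightarrow> r \<in> polys V \<Longrightarrow> p = \<sigma> + r * (norm2_poly V - 1) \<Longrightarrow> p \<in> sphere_preorder V"
  by (auto simp: sphere_preorder_def)

text \<open>On the sphere \<open>p^2 + s = 1\<close>, where \<open>s\<close> sums the other squares,
  so \<open>1 + p\<close> is half of \<open>(1 + p)^2 + s\<close>. The hypothesis on
  \<open>p^2\<close> covers both \<open>Var v\<close> and \<open>- Var v\<close>.\<close>

lemma linear_in_sphere_preorder: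
  assumes "finite V" "p\<^sup>2 = (Var v)\<^sup>2" "p \<in> polys V" "v \<in> V"
  shows "1 + p \<in> sphere_preorder V"
proof (rule sphere_preorderI)
  define s where "s = (\<Sum>w\<in>V - {v}. (Var w :: 'a mpoly)\<^sup>2)"
  \<comment> \<open>One half, written as a square so that \<open>sos_square_mult\<close>
    applies.\<close>
  define c where "c = (Const (sqrt (1/2)) :: 'a mpoly)\<^sup>2"
  have cc: "c + c = 1"
    by (simp add: c_def Const_power[symmetric] Const_add[symmetric] Const_1[symmetric])
  have n: "norm2_poly V = p\<^sup>2 + s"
    unfolding norm2_poly_def s_def assms(2) using assms(1,4) by (rule sum.remove)
  show "c * ((1 + p)\<^sup>2 + s) \<in> sos V"
    unfolding c_def s_def using assms
    by (intro sos_square_mult sos_add sos_square sos_sum polys_intros) auto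
  show "- c \<in> polys V"
    by (auto simp: c_def intro!: polys_intros)
  show "1 + p = c * ((1 + p)\<^sup>2 + s) + - c * (norm2_poly V - 1)"
  proof -
    have "c * ((1 + p)\<^sup>2 + s) + - c * (p\<^sup>2 + s - 1) = (c + c) * (1 + p)"
      by (simp add: power2_eq_square algebra_simps)
    then show ?thesis by (simp add: cc n)
  qed
qed

lemma cube_preordering_sphere:
  assumes "finite (V :: 'v::countable set)"
  shows "cube_preordering V (sphere_preorder V)"
proof
  show "finite V" by fact
next
  fix p q assume "p \<in> sphere_preorder V" "q \<in> sphere_preorder V"
  then obtain \<sigma> r \<tau> t where
    p: "p = \<sigma> + r * (norm2_poly V - 1)" "\<sigma> \<in> sos V" "r \<in> polys V" and
    q: "q = \<tau> + t * (norm2_poly V - 1)" "\<tau> \<in> sos V" "t \<in> polys V"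
    by (auto simp: sphere_preorder_def)
  show "p + q \<in> sphere_preorder V"
    by (rule sphere_preorderI[of "\<sigma> + \<tau>" _ "r + t"])
       (use p q in \<open>auto intro!: sos_add polys_add simp: algebra_simps\<close>)
  show "p * q \<in> sphere_preorder V"
  proof (rule sphere_preorderI)
    show "\<sigma> * \<tau> \<in> sos V" using p q by (intro sos_mult)
    show "\<sigma> * t + r * \<tau> + r * t * (norm2_poly V - 1) \<in> polys V"
      using p q sos_in_polys[OF p(2)] sos_in_polys[OF q(2)] by (auto intro!: polys_intros)
    show "p * q = \<sigma> * \<tau> + (\<sigma> * t + r * \<tau> + r * t * (norm2_poly V - 1)) * (norm2_poly V - 1)"
      unfolding p(1) q(1) by (simp add: algebra_simps)
  qed
next
  fix p :: "'v mpoly" assume "p \<in> polys V"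
  then show "p\<^sup>2 \<in> sphere_preorder V"
    by (intro sphere_preorderI[of "p\<^sup>2" _ 0] sos_square) auto
next
  fix v assume "v \<in> V"
  then show "1 + Var v \<in> sphere_preorder V" "1 - Var v \<in> sphere_preorder V"
    using linear_in_sphere_preorder[OF assms, of "Var v" v]
      linear_in_sphere_preorder[OF assms, of "- Var v" v] polys_uminus[of "Var v" V] by auto
qed

lemma abs_le_1_of_norm2:
  assumes "finite V" "v \<in> V" "norm2 V u \<le> 1"
  shows "\<bar>u v\<bar> \<le> 1"
proof -
  have "(u v)\<^sup>2 \<le> norm2 V u"
    unfolding norm2_def using assms by (intro member_le_sum) auto
  then show ?thesis using assms(3) by (simp add: abs_square_le_1[symmetric])
qed

text \<open>Two eliminations. The inequalities \<open>g i\<close> are removed on the compact set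
  \<open>K\<close> cut out by the equations. The equations are then treated on the whole cube as the
  single inequality \<open>- (n^2 + e^2) \<ge> 0\<close>, whose square multiplier yields polynomial
  multiples of \<open>n\<close> and \<open>e\<close>. What remains is positive on the cube and hence
  lies in \<open>sphere_preorder V\<close>.\<close>

theorem putinar_sphere:
  fixes V :: "'v::countable set"
  assumes V: "finite V" and I: "finite I" and g: "\<And>i. i \<in> I \<Longrightarrow> g i \<in> polys V"
    and e: "e \<in> polys V" and p: "p \<in> polys V"
    and pos: "\<And>u. u \<in> space_on V \<Longrightarrow> norm2 V u = 1 \<Longrightarrow> eval u e = 0 \<Longrightarrow>
      (\<And>i. i \<in> I \<Longrightarrow> 0 \<le> eval u (g i)) \<Longrightarrow> 0 < eval u p"
  obtains \<sigma>0 \<sigma> r t where "\<sigma>0 \<in> sos V" "\<And>i. i \<in> I \<Longrightarrow> \<sigma> i \<in> sos V" "r \<in> polys V" "t \<in> polys V"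
    "p = \<sigma>0 + (\<Sum>i\<in>I. \<sigma> i * g i) + r * (norm2_poly V - 1) + t * e"
proof -
  define K where "K = cube V \<inter> {u. eval u (norm2_poly V) = 1} \<inter> {u. eval u e = 0}"
  have K: "compact K" "K \<subseteq> space_on V"
    unfolding K_def
    by (intro compact_Int_closed compact_cube closed_Collect_eq continuous_on_eval
        continuous_on_id continuous_on_const) (auto simp: cube_def)
  have "0 < eval u p" if "u \<in> K" "\<And>i. i \<in> I \<Longrightarrow> 0 \<le> eval u (g i)" for u
    using that by (intro pos) (auto simp: K_def cube_def eval_norm2_poly)
  from eliminate_constraints[OF I K this] obtain s where
    s: "\<forall>i\<in>I. s i \<in> polys V" "\<forall>u\<in>K. 0 < eval u (p - (\<Sum>i\<in>I. (s i)\<^sup>2 * g i))"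
    by blast
  define n where "n = norm2_poly V - 1"
  have n: "n \<in> polys V" unfolding n_def by (intro polys_intros) auto
  have "\<exists>s'\<in>polys V. \<forall>u\<in>cube V.
      0 < eval u ((p - (\<Sum>i\<in>I. (s i)\<^sup>2 * g i)) - s'\<^sup>2 * (- (n\<^sup>2 + e\<^sup>2)))"
  proof (rule eliminate_constraint[OF compact_cube])
    show "cube V \<subseteq> space_on V" by (auto simp: cube_def)
    fix u assume u: "u \<in> cube V" "0 \<le> eval u (- (n\<^sup>2 + e\<^sup>2))"
    then have "(eval u n)\<^sup>2 + (eval u e)\<^sup>2 \<le> 0" by (simp add: eval_simps)
    then have "eval u n = 0" "eval u e = 0"
      by (simp_all add: sum_power2_le_zero_iff)
    with u have "u \<in> K" by (simp add: K_def n_def eval_diff eval_1)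
    with s(2) show "0 < eval u (p - (\<Sum>i\<in>I. (s i)\<^sup>2 * g i))" by blast
  qed
  then obtain s' where s': "s' \<in> polys V" "\<And>u. u \<in> cube V \<Longrightarrow>
      0 < eval u ((p - (\<Sum>i\<in>I. (s i)\<^sup>2 * g i)) - s'\<^sup>2 * (- (n\<^sup>2 + e\<^sup>2)))"
    by blast
  interpret cube_preordering V "sphere_preorder V"
    using V by (rule cube_preordering_sphere)
  have "(p - (\<Sum>i\<in>I. (s i)\<^sup>2 * g i)) - s'\<^sup>2 * (- (n\<^sup>2 + e\<^sup>2)) \<in> sphere_preorder V"
    using s s'(1) p g e n by (intro positive_on_cube s'(2) polys_intros) auto
  then obtain \<sigma>0 r where \<sigma>0: "\<sigma>0 \<in> sos V" "r \<in> polys V" and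
    eq: "(p - (\<Sum>i\<in>I. (s i)\<^sup>2 * g i)) - s'\<^sup>2 * (- (n\<^sup>2 + e\<^sup>2)) = \<sigma>0 + r * n"
    unfolding sphere_preorder_def n_def by blast
  show thesis
  proof
    show "\<sigma>0 \<in> sos V" by fact
    show "\<And>i. i \<in> I \<Longrightarrow> (s i)\<^sup>2 \<in> sos V" using s by (auto intro: sos_square)
    show "r - s'\<^sup>2 * n \<in> polys V" "- (s'\<^sup>2 * e) \<in> polys V"
      using \<sigma>0 s' n e by (auto intro!: polys_intros)
    show "p = \<sigma>0 + (\<Sum>i\<in>I. (s i)\<^sup>2 * g i) + (r - s'\<^sup>2 * n) * (norm2_poly V - 1) + - (s'\<^sup>2 * e) * e"
    proof -
      have "p = ((p - (\<Sum>i\<in>I. (s i)\<^sup>2 * g i)) - s'\<^sup>2 * (- (n\<^sup>2 + e\<^sup>2))) +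
          (\<Sum>i\<in>I. (s i)\<^sup>2 * g i) + s'\<^sup>2 * (- (n\<^sup>2 + e\<^sup>2))"
        by simp
      then show ?thesis
        unfolding eq n_def[symmetric] by (simp add: power2_eq_square algebra_simps)
    qed
  qed
qed

section \<open>Homogenization and the certificate\<close>

lemma homogenize_uminus: "homogenize x0 (- p) = - homogenize x0 p"
  by (simp add: homogenize_def total_degree_def single_uminus sum_negf)

lemma norm2_insert: "finite V \<Longrightarrow> v \<notin> V \<Longrightarrow> norm2 (insert v V) u = (u v)\<^sup>2 + norm2 V u"
  by (simp add: norm2_def)

lemma norm2_union:
  "finite V \<Longrightarrow> finite U \<Longrightarrow> V \<inter> U = {} \<Longrightarrow> norm2 (V \<union> U) u = norm2 V u + norm2 U u"
  by (simp add: norm2_def sum.union_disjoint)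

lemma norm2_nonneg: "0 \<le> norm2 V u"
  by (simp add: norm2_def sum_nonneg)

lemma norm2_divide: "norm2 V (\<lambda>v. u v / c) = norm2 V u / c\<^sup>2"
  by (simp add: norm2_def power_divide sum_divide_distrib)

lemma norm2_cong: "(\<And>v. v \<in> V \<Longrightarrow> u v = u' v) \<Longrightarrow> norm2 V u = norm2 V u'"
  by (simp add: norm2_def)

lemma continuous_on_norm2:
  assumes "continuous_on S F"
  shows "continuous_on S (\<lambda>x. norm2 V (F x))"
proof -
  have "continuous_on S (\<lambda>x. F x v)" for v
    using assms by (rule continuous_on_product_then_coordinatewise)
  then show ?thesis
    unfolding norm2_def by (intro continuous_intros)
qed

text \<open>On the part \<open>X0 > 0\<close> of the homogenized set, \<open>l\<close> positive on \<open>S\<close> makes its homogenization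
  positive; closedness at infinity extends the weak inequality to all of it.\<close>

lemma homogenize_nonneg:
  fixes V U :: "var set" and F :: "var mpoly set"
  assumes fin: "finite V" "finite U" and VU: "V \<inter> U = {}"
    and fresh: "X0 \<notin> V \<union> U" "W \<notin> V \<union> U"
    and F: "F \<subseteq> polys (V \<union> U)"
    and closed: "closed_at_infinity X0 (V \<union> U) F"
    and l: "l \<in> polys (insert W V)"
    and pos: "\<And>u. u \<in> semialg (V \<union> U) F \<Longrightarrow> 0 < eval ((proj V u)(W := sqrt (norm2 V u + 1))) l"
    and u: "norm2 ({X0, W} \<union> V \<union> U) u = 1" "(u X0)\<^sup>2 + norm2 V u = (u W)\<^sup>2"
      "\<And>p. p \<in> F \<Longrightarrow> 0 \<le> eval u (homogenize X0 p)" "0 \<le> u X0" "0 \<le> u W"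
  shows "0 \<le> eval u (homogenize X0 l)"
proof -
  let ?A = "V \<union> U" and ?L = "homogenize X0 l"
  \<comment> \<open>Substituting the nonnegative root for \<open>W\<close> gives a continuous
    function on the whole space, including \<open>X0 = 0\<close>, so that its sign passes to the
    closure.\<close>
  define \<Psi> where "\<Psi> v = eval (v(W := sqrt ((v X0)\<^sup>2 + norm2 V v))) ?L" for v :: "var \<Rightarrow> real"
  have L: "?L \<in> polys (insert X0 (insert W V))"
    using l by (rule polys_homogenize)
  have pos_h: "0 \<le> \<Psi> v" if v: "v \<in> semialg_tilde_h X0 ?A F" for v
  proof -
    define c where "c = v X0"
    have c: "0 < c" using v by (simp add: c_def semialg_tilde_h_def)
    \<comment> \<open>Dehomogenization: dividing by the positive coordinate \<open>X0\<close> leads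
      back to a point of the affine set.\<close>
    define y where "y = proj ?A (\<lambda>x. v x / c)"
    have "y \<in> semialg ?A F"
      unfolding semialg_def
    proof (intro CollectI conjI ballI)
      show "y \<in> space_on ?A" by (simp add: y_def space_on_def proj_def)
      fix p assume p: "p \<in> F"
      then have "0 \<le> eval v (homogenize X0 p)" using v by (simp add: semialg_tilde_h_def)
      also have "\<dots> = c ^ total_degree p * eval (\<lambda>x. v x / c) p"
        unfolding c_def using c by (intro eval_homogenize) (simp add: c_def)
      finally have "0 \<le> eval (\<lambda>x. v x / c) p"
        using zero_less_power[OF c, of "total_degree p"] by (simp add: zero_le_mult_iff)
      also have "\<dots> = eval y p"
        using F p by (intro eval_cong[of _ ?A]) (auto simp: y_def proj_def)
      finally show "0 \<le> eval y p" .
    qed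
    from pos[OF this] have "0 < eval ((proj V y)(W := sqrt (norm2 V y + 1))) l" .
    also have "\<dots> = eval (\<lambda>x. (v(W := sqrt ((v X0)\<^sup>2 + norm2 V v))) x / c) l"
    proof (rule eval_cong[OF l])
      fix x assume x: "x \<in> insert W V"
      have "norm2 V y = norm2 V v / c\<^sup>2"
        unfolding norm2_divide[symmetric] by (rule norm2_cong) (simp add: y_def proj_def)
      then have "norm2 V y + 1 = ((v X0)\<^sup>2 + norm2 V v) / c\<^sup>2"
        using c by (simp add: c_def field_simps)
      then have "sqrt (norm2 V y + 1) = sqrt ((v X0)\<^sup>2 + norm2 V v) / c"
        using c by (simp add: real_sqrt_divide)
      with x show "((proj V y)(W := sqrt (norm2 V y + 1))) x =
          (v(W := sqrt ((v X0)\<^sup>2 + norm2 V v))) x / c"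
        by (auto simp: y_def proj_def)
    qed
    finally have "0 < c ^ total_degree l *
        eval (\<lambda>x. (v(W := sqrt ((v X0)\<^sup>2 + norm2 V v))) x / c) l"
      using c by simp
    moreover have "\<Psi> v = c ^ total_degree l *
        eval (\<lambda>x. (v(W := sqrt ((v X0)\<^sup>2 + norm2 V v))) x / c) l"
      unfolding \<Psi>_def using c
      by (subst eval_homogenize) (simp_all add: c_def)
    ultimately show ?thesis by simp
  qed
  have "continuous_on UNIV \<Psi>"
    unfolding \<Psi>_def
  proof (intro continuous_on_eval continuous_on_coordinatewise_then_product)
    fix x
    have "continuous_on UNIV (\<lambda>v::var \<Rightarrow> real. sqrt ((v X0)\<^sup>2 + norm2 V v))"
      by (intro continuous_intros continuous_on_norm2 continuous_on_id continuous_on_product_coordinates)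
    then show "continuous_on UNIV (\<lambda>v. (v(W := sqrt ((v X0)\<^sup>2 + norm2 V v))) x)"
      by (cases "x = W") simp_all
  qed
  then have "closed {v. 0 \<le> \<Psi> v}"
    by (intro closed_Collect_le continuous_intros)
  then have "closure (semialg_tilde_h X0 ?A F) \<subseteq> {v. 0 \<le> \<Psi> v}"
    using pos_h by (intro closure_minimal) auto
  then have pos_tilde: "0 \<le> \<Psi> v" if "v \<in> semialg_tilde X0 ?A F" for v
    using that closed by (auto simp: closed_at_infinity_def)
  have "{X0, W} \<union> V \<union> U = insert X0 (insert W ?A)" by auto
  then have sum1: "(u X0)\<^sup>2 + (u W)\<^sup>2 + norm2 ?A u = 1"
    using u(1) fin fresh by (simp add: norm2_insert)
  \<comment> \<open>Dropping \<open>W\<close> from \<open>u\<close> and dividing by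
    \<open>\<rho>\<close> gives a point of the sphere without \<open>W\<close>. If
    \<open>\<rho>\<close> vanished, the cone equation would force \<open>u W = 0\<close>, against
    \<open>sum1\<close>.\<close>
  define \<rho> where "\<rho> = sqrt ((u X0)\<^sup>2 + norm2 ?A u)"
  have "(u W)\<^sup>2 \<le> (u X0)\<^sup>2 + norm2 ?A u"
    using u(2) norm2_nonneg[of U u] fin VU by (simp add: norm2_union)
  with sum1 have pos_rho2: "0 < (u X0)\<^sup>2 + norm2 ?A u" by linarith
  then have \<rho>: "0 < \<rho>" "\<rho>\<^sup>2 = (u X0)\<^sup>2 + norm2 ?A u" by (simp_all add: \<rho>_def)
  define v where "v = proj (insert X0 ?A) (\<lambda>x. u x / \<rho>)"
  have "v \<in> semialg_tilde X0 ?A F"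
    unfolding semialg_tilde_def
  proof (intro CollectI conjI ballI)
    show "v \<in> space_on (insert X0 ?A)" by (simp add: v_def space_on_def proj_def)
    show "0 \<le> v X0" using u(4) \<rho> by (simp add: v_def proj_def)
    have "norm2 ?A v = norm2 ?A u / \<rho>\<^sup>2"
      unfolding norm2_divide[symmetric] by (rule norm2_cong) (simp add: v_def proj_def)
    then have "(v X0)\<^sup>2 + norm2 ?A v = ((u X0)\<^sup>2 + norm2 ?A u) / \<rho>\<^sup>2"
      by (simp add: v_def proj_def power_divide add_divide_distrib)
    then show "(v X0)\<^sup>2 + norm2 ?A v = 1"
      using \<rho>(2) pos_rho2 by simp
    fix p assume p: "p \<in> F"
    have "homogenize X0 p \<in> polys (insert X0 ?A)"
      using p F by (auto intro: polys_homogenize)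
    then have "eval v (homogenize X0 p) = eval (\<lambda>x. (1 / \<rho>) * u x) (homogenize X0 p)"
      by (rule eval_cong) (simp add: v_def proj_def)
    then show "0 \<le> eval v (homogenize X0 p)"
      unfolding eval_scale_homogenize using u(3)[OF p] \<rho> by simp
  qed
  then have "0 \<le> \<Psi> v" by (rule pos_tilde)
  \<comment> \<open>By the cone equation and \<open>0 \<le> u W\<close>, the root substituted for
    \<open>W\<close> at \<open>v\<close> is exactly \<open>u W / \<rho>\<close>. So
    \<open>\<Psi> v\<close> is the homogenization at a positive multiple of \<open>u\<close>, which
    has the same sign as at \<open>u\<close>.\<close>
  also have "\<Psi> v = eval (\<lambda>x. (1 / \<rho>) * u x) ?L"
    unfolding \<Psi>_def
  proof (rule eval_cong[OF L])
    fix x assume x: "x \<in> insert X0 (insert W V)"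
    have "norm2 V v = norm2 V u / \<rho>\<^sup>2"
      unfolding norm2_divide[symmetric] by (rule norm2_cong) (simp add: v_def proj_def)
    then have "(v X0)\<^sup>2 + norm2 V v = (u W / \<rho>)\<^sup>2"
      by (simp add: v_def proj_def power_divide u(2)[symmetric] add_divide_distrib)
    then have "sqrt ((v X0)\<^sup>2 + norm2 V v) = u W / \<rho>"
      using u(5) \<rho>(1) by simp
    with x show "(v(W := sqrt ((v X0)\<^sup>2 + norm2 V v))) x = (1 / \<rho>) * u x"
      by (auto simp: v_def proj_def)
  qed
  finally have "0 \<le> (1 / \<rho>) ^ total_degree l * eval u ?L"
    by (simp only: eval_scale_homogenize)
  moreover have "0 < (1 / \<rho>) ^ total_degree l" using \<rho>(1) by simp
  ultimately show ?thesis by (simp add: zero_le_mult_iff)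
qed

text \<open>\<open>homogenize_nonneg\<close> yields only a weak inequality at infinity; adding
  \<open>\<epsilon>\<close> makes it strict, as \<open>putinar_sphere\<close> requires. The members
  \<open>m + 3\<close> and \<open>m + 4\<close> of the family enter as equations, hence their
  multipliers are arbitrary polynomials.\<close>

lemma homogenize_certificate:
  fixes V U :: "var set" and f :: "nat \<Rightarrow> var mpoly"
  assumes fin: "finite V" "finite U" and VU: "V \<inter> U = {}"
    and fresh: "X0 \<notin> V \<union> U" "W \<notin> V \<union> U"
    and f: "\<And>i. i \<in> {1..m} \<Longrightarrow> f i \<in> polys (V \<union> U)"
    and closed: "closed_at_infinity X0 (V \<union> U) (f ` {1..m})"
    and l: "l \<in> polys (insert W V)"
    and pos: "\<And>u. u \<in> semialg (V \<union> U) (f ` {1..m}) \<Longrightarrow>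
      0 < eval ((proj V u)(W := sqrt (norm2 V u + 1))) l"
    and "0 < \<epsilon>"
  shows "\<exists>\<sigma>. (\<forall>i\<in>{0..m+2}. \<sigma> i \<in> sos ({X0, W} \<union> V \<union> U)) \<and>
    (\<forall>i\<in>{m+3..m+4}. \<sigma> i \<in> polys ({X0, W} \<union> V \<union> U)) \<and>
    homogenize X0 l + Const \<epsilon> = \<sigma> 0 + (\<Sum>i=1..m+4. \<sigma> i * ext_family V U m f i)"
proof -
  let ?V = "{X0, W} \<union> V \<union> U" and ?f = "ext_family V U m f"
  define e where "e = (Var X0)\<^sup>2 + norm2_poly V - (Var W)\<^sup>2"
  have fi: "?f i \<in> polys ?V" if "i \<in> {1..m+2}" for i
  proof (cases "i \<le> m")
    case True
    then have "homogenize X0 (f i) \<in> polys (insert X0 (V \<union> U))"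
      using f that by (auto intro: polys_homogenize)
    then have "homogenize X0 (f i) \<in> polys ?V"
      by (rule polys_mono[rotated]) auto
    with True show ?thesis by (simp add: ext_family_def)
  next
    case False
    with that have "i = m + 1 \<or> i = m + 2" by auto
    then show ?thesis by (auto simp: ext_family_def)
  qed
  have "homogenize X0 l \<in> polys (insert X0 (insert W V))"
    using l by (rule polys_homogenize)
  then have "homogenize X0 l \<in> polys ?V" by (rule polys_mono[rotated]) auto
  then have p: "homogenize X0 l + Const \<epsilon> \<in> polys ?V" by (intro polys_intros)
  have V: "finite ?V" using fin by simp
  have e: "e \<in> polys ?V" unfolding e_def by (intro polys_intros) auto
  obtain \<sigma>0 \<sigma> r t where \<sigma>: "\<sigma>0 \<in> sos ?V" "\<And>i. i \<in> {1..m+2} \<Longrightarrow> \<sigma> i \<in> sos ?V"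
    "r \<in> polys ?V" "t \<in> polys ?V" and
    eq: "homogenize X0 l + Const \<epsilon> =
      \<sigma>0 + (\<Sum>i=1..m+2. \<sigma> i * ?f i) + r * (norm2_poly ?V - 1) + t * e"
  proof (rule putinar_sphere[OF V _ fi e p])
    show "finite {1..m+2}" by simp
    fix u assume u: "norm2 ?V u = 1" "eval u e = 0" "\<And>i. i \<in> {1..m+2} \<Longrightarrow> 0 \<le> eval u (?f i)"
    have "0 \<le> eval u (homogenize X0 l)"
    proof (rule homogenize_nonneg[OF fin VU fresh _ closed l pos u(1)])
      show "f ` {1..m} \<subseteq> polys (V \<union> U)" using f by auto
      show "(u X0)\<^sup>2 + norm2 V u = (u W)\<^sup>2" using u(2) by (simp add: e_def eval_simps)
      show "0 \<le> u X0" using u(3)[of "m + 1"] by (simp add: ext_family_def eval_Var)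
      show "0 \<le> u W" using u(3)[of "m + 2"] by (simp add: ext_family_def eval_Var)
      fix q assume "q \<in> f ` {1..m}"
      then obtain i where "i \<in> {1..m}" "q = f i" by blast
      then show "0 \<le> eval u (homogenize X0 q)"
        using u(3)[of i] by (simp add: ext_family_def)
    qed
    then show "0 < eval u (homogenize X0 l + Const \<epsilon>)"
      using \<open>0 < \<epsilon>\<close> by (simp add: eval_simps)
  qed (assumption | rule that)+
  \<comment> \<open>Index \<open>0\<close> carries the free sum of squares, \<open>m + 3\<close> the
    sphere equation, and the remaining default \<open>t\<close> belongs to the cone equation at
    \<open>m + 4\<close>.\<close>
  define \<tau> where "\<tau> i = (if i = 0 then \<sigma>0 else if i \<le> m + 2 then \<sigma> i else if i = m + 3 then r else t)" for i
  have "?V = insert X0 (insert W (V \<union> U))" by auto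
  then have "norm2_poly ?V = (Var X0)\<^sup>2 + norm2_poly V + (Var W)\<^sup>2 + norm2_poly U"
    using fin fresh VU by (simp add: norm2_poly_def sum.union_disjoint)
  then have f3: "?f (m + 3) = norm2_poly ?V - 1" by (simp add: ext_family_def)
  have f4: "?f (m + 4) = e" by (simp add: ext_family_def e_def)
  have "{1..m+4} = insert (m+4) (insert (m+3) {1..m+2})" by auto
  then have "(\<Sum>i=1..m+4. \<tau> i * ?f i) = t * e + (r * (norm2_poly ?V - 1) + (\<Sum>i=1..m+2. \<tau> i * ?f i))"
    by (simp add: f3 f4 \<tau>_def)
  also have "(\<Sum>i=1..m+2. \<tau> i * ?f i) = (\<Sum>i=1..m+2. \<sigma> i * ?f i)"
    by (intro sum.cong) (auto simp: \<tau>_def)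
  finally have "homogenize X0 l + Const \<epsilon> = \<tau> 0 + (\<Sum>i=1..m+4. \<tau> i * ?f i)"
    unfolding eq by (simp add: \<tau>_def algebra_simps)
  moreover have "\<forall>i\<in>{0..m+2}. \<tau> i \<in> sos ?V" "\<forall>i\<in>{m+3..m+4}. \<tau> i \<in> polys ?V"
    using \<sigma> by (auto simp: \<tau>_def)
  ultimately show ?thesis by blast
qed

section \<open>Separating the compactified projections\<close>

text \<open>The sphere equation bounds every coordinate by 1, so this is a closed part of a compact
  cube.\<close>

lemma compact_semialg_tilde:
  assumes "finite V"
  shows "compact (semialg_tilde x0 V P)"
proof -
  have c: "continuous_on UNIV (\<lambda>u. eval u p)" for p :: "'a mpoly"
    by (intro continuous_on_eval continuous_on_id)
  have n: "continuous_on UNIV (\<lambda>u. norm2 V u)"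
    by (intro continuous_on_norm2 continuous_on_id)
  have "semialg_tilde x0 V P \<subseteq> cube (insert x0 V)"
  proof
    fix u assume u: "u \<in> semialg_tilde x0 V P"
    have "\<bar>u v\<bar> \<le> 1" for v
    proof -
      have sum1: "(u x0)\<^sup>2 + norm2 V u = 1" using u by (simp add: semialg_tilde_def)
      consider "v = x0" | "v \<in> V" | "v \<notin> insert x0 V" by auto
      then show ?thesis
      proof cases
        case 1
        then show ?thesis
          using sum1 norm2_nonneg[of V u] by (simp add: abs_square_le_1[symmetric])
      next
        case 2
        have "norm2 V u \<le> 1" using sum1 by (smt (verit) zero_le_power2)
        with 2 show ?thesis by (rule abs_le_1_of_norm2[OF assms])
      next
        case 3
        then show ?thesis using u by (simp add: semialg_tilde_def space_on_def)
      qed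
    qed
    then show "u \<in> cube (insert x0 V)" using u by (simp add: cube_def semialg_tilde_def)
  qed
  then have "semialg_tilde x0 V P = cube (insert x0 V) \<inter> ((\<Inter>p\<in>P. {u. 0 \<le> eval u (homogenize x0 p)}) \<inter>
      ({u. 0 \<le> u x0} \<inter> {u. (u x0)\<^sup>2 + norm2 V u = 1}))"
    by (auto simp: semialg_tilde_def cube_def)
  also have "compact \<dots>"
    by (intro compact_Int_closed compact_cube closed_Int closed_INT ballI closed_Collect_le
        closed_Collect_eq continuous_on_const c n continuous_on_add continuous_on_power
        continuous_on_product_coordinates)
  finally show ?thesis .
qed

text \<open>Central projection of the affine chart \<open>x0 = 1\<close> onto the open upper half of
  the unit sphere.\<close>

definition sphere_point :: "'v \<Rightarrow> 'v set \<Rightarrow> ('v \<Rightarrow> real) \<Rightarrow> 'v \<Rightarrow> real" where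
  "sphere_point x0 V x = (\<lambda>v. (x(x0 := 1)) v / sqrt (norm2 V x + 1))"

lemma sqrt_norm2_pos: "0 < sqrt (norm2 V x + 1)"
  using norm2_nonneg[of V x] by simp

text \<open>At \<open>x0 = 1\<close> the homogenization takes the value of \<open>p\<close> itself,
  and rescaling by a positive factor preserves its sign.\<close>

lemma sphere_point_in_tilde:
  assumes "x0 \<notin> V" "P \<subseteq> polys V" "x \<in> semialg V P"
  shows "sphere_point x0 V x \<in> semialg_tilde x0 V P"
  unfolding semialg_tilde_def
proof (intro CollectI conjI ballI)
  let ?s = "sqrt (norm2 V x + 1)"
  show "sphere_point x0 V x \<in> space_on (insert x0 V)"
    using assms(3) by (simp add: sphere_point_def semialg_def space_on_def)
  show "0 \<le> sphere_point x0 V x x0"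
    using sqrt_norm2_pos[of V x] by (simp add: sphere_point_def)
  have "norm2 V (sphere_point x0 V x) = norm2 V (\<lambda>v. x v / ?s)"
    using assms(1) by (intro norm2_cong) (auto simp: sphere_point_def)
  then show "(sphere_point x0 V x x0)\<^sup>2 + norm2 V (sphere_point x0 V x) = 1"
    using norm2_nonneg[of V x] by (simp add: norm2_divide sphere_point_def field_simps)
  fix p assume p: "p \<in> P"
  have "eval (x(x0 := 1)) (homogenize x0 p) = eval (x(x0 := 1)) p"
    by (subst eval_homogenize) (simp_all add: fun_upd_def)
  also have "\<dots> = eval x p"
    using assms(1,2) p by (intro eval_cong[of p V]) auto
  finally have "eval (x(x0 := 1)) (homogenize x0 p) = eval x p" .
  moreover have "eval (sphere_point x0 V x) (homogenize x0 p) =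
      (1 / ?s) ^ total_degree p * eval (x(x0 := 1)) (homogenize x0 p)"
    unfolding eval_scale_homogenize[symmetric] by (simp add: sphere_point_def)
  moreover have "0 \<le> eval x p" using assms(3) p by (simp add: semialg_def)
  ultimately show "0 \<le> eval (sphere_point x0 V x) (homogenize x0 p)"
    using sqrt_norm2_pos[of V x] by simp
qed

text \<open>Write \<open>s = sqrt (norm2 V x + 1)\<close>. A power of \<open>s\<close> clears the
  denominators of the sphere point; since \<open>s^2\<close> is a polynomial in \<open>x\<close>, at
  most one factor \<open>s\<close> survives.\<close>

lemma sphere_polynomial_decomposition:
  assumes "q \<in> polys (insert x0 V)" "x0 \<notin> V"
  shows "\<exists>k. \<exists>h1\<in>polys V. \<exists>h2\<in>polys V. \<forall>x. sqrt (norm2 V x + 1) ^ k * eval (sphere_point x0 V x) q =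
    eval x h1 + sqrt (norm2 V x + 1) * eval x h2"
  using assms(1)
proof (induction rule: polys_induct)
  case (Const c)
  show ?case
    by (intro exI[of _ 0] bexI[of _ "Const c"] bexI[of _ 0]) (auto simp: eval_simps)
next
  case (add p q)
  \<comment> \<open>Two summands need a common exponent. One more factor \<open>s\<close> exchanges
    the two parts: \<open>s * (h1 + s * h2) = (norm2 V x + 1) * h2 + s * h1\<close>.\<close>
  have raise: "\<exists>h1\<in>polys V. \<exists>h2\<in>polys V. \<forall>x. sqrt (norm2 V x + 1) ^ (j + k) * F x =
      eval x h1 + sqrt (norm2 V x + 1) * eval x h2"
    if "\<exists>h1\<in>polys V. \<exists>h2\<in>polys V. \<forall>x. sqrt (norm2 V x + 1) ^ k * F x =
      eval x h1 + sqrt (norm2 V x + 1) * eval x h2" for F :: "('a \<Rightarrow> real) \<Rightarrow> real" and j k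
  proof (induction j)
    case 0
    then show ?case using that by simp
  next
    case (Suc j)
    then obtain h1 h2 where h: "h1 \<in> polys V" "h2 \<in> polys V" and
      eq: "\<And>x. sqrt (norm2 V x + 1) ^ (j + k) * F x = eval x h1 + sqrt (norm2 V x + 1) * eval x h2"
      by blast
    have "sqrt (norm2 V x + 1) ^ (Suc j + k) * F x =
        eval x ((norm2_poly V + 1) * h2) + sqrt (norm2 V x + 1) * eval x h1" for x
    proof -
      have s2: "sqrt (norm2 V x + 1) * sqrt (norm2 V x + 1) = norm2 V x + 1"
        using norm2_nonneg[of V x] by simp
      have "sqrt (norm2 V x + 1) ^ (Suc j + k) * F x =
          sqrt (norm2 V x + 1) * (eval x h1 + sqrt (norm2 V x + 1) * eval x h2)"
        by (simp add: eq[symmetric] mult.assoc)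
      also have "\<dots> = (sqrt (norm2 V x + 1) * sqrt (norm2 V x + 1)) * eval x h2 +
          sqrt (norm2 V x + 1) * eval x h1"
        by (simp only: algebra_simps)
      finally show ?thesis unfolding s2 by (simp add: eval_simps)
    qed
    moreover have "(norm2_poly V + 1) * h2 \<in> polys V"
      using h by (intro polys_intros) auto
    ultimately show ?case using h(1) by blast
  qed
  obtain k where p: "\<exists>h1\<in>polys V. \<exists>h2\<in>polys V. \<forall>x. sqrt (norm2 V x + 1) ^ k * eval (sphere_point x0 V x) p =
      eval x h1 + sqrt (norm2 V x + 1) * eval x h2" using add.IH by blast
  obtain j where q: "\<exists>h1\<in>polys V. \<exists>h2\<in>polys V. \<forall>x. sqrt (norm2 V x + 1) ^ j * eval (sphere_point x0 V x) q =
      eval x h1 + sqrt (norm2 V x + 1) * eval x h2" using add.IH by blast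
  obtain h1 h2 where h: "h1 \<in> polys V" "h2 \<in> polys V"
    "\<And>x. sqrt (norm2 V x + 1) ^ (j + k) * eval (sphere_point x0 V x) p =
      eval x h1 + sqrt (norm2 V x + 1) * eval x h2"
    using raise[OF p, of j] by blast
  obtain h1' h2' where h': "h1' \<in> polys V" "h2' \<in> polys V"
    "\<And>x. sqrt (norm2 V x + 1) ^ (j + k) * eval (sphere_point x0 V x) q =
      eval x h1' + sqrt (norm2 V x + 1) * eval x h2'"
    using raise[OF q, of k] by (auto simp: add.commute)
  show ?case
    using h h' by (intro exI[of _ "j + k"] bexI[of _ "h1 + h1'"] bexI[of _ "h2 + h2'"] allI)
      (auto simp: eval_add distrib_left intro: polys_add)
next
  case (Var_mult v p)
  obtain k h1 h2 where h: "h1 \<in> polys V" "h2 \<in> polys V"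
    "\<And>x. sqrt (norm2 V x + 1) ^ k * eval (sphere_point x0 V x) p =
      eval x h1 + sqrt (norm2 V x + 1) * eval x h2"
    using Var_mult.IH by blast
  \<comment> \<open>The coordinate \<open>v\<close> of the sphere point, multiplied by
    \<open>s\<close>; the coordinate \<open>x0\<close> becomes 1.\<close>
  define y where "y = (if v = x0 then 1 else Var v)"
  have y: "y \<in> polys V" using Var_mult.hyps(1) by (auto simp: y_def)
  have "sqrt (norm2 V x + 1) ^ Suc k * eval (sphere_point x0 V x) (Var v * p) =
      eval x (y * h1) + sqrt (norm2 V x + 1) * eval x (y * h2)" for x
  proof -
    have "sqrt (norm2 V x + 1) * sphere_point x0 V x v = eval x y"
      using sqrt_norm2_pos[of V x] by (simp add: sphere_point_def y_def eval_simps)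
    moreover have "sqrt (norm2 V x + 1) ^ Suc k * eval (sphere_point x0 V x) (Var v * p) =
        (sqrt (norm2 V x + 1) * sphere_point x0 V x v) *
        (sqrt (norm2 V x + 1) ^ k * eval (sphere_point x0 V x) p)"
      by (simp add: eval_simps)
    ultimately show ?thesis
      unfolding h(3) by (simp add: eval_mult algebra_simps)
  qed
  moreover have "y * h1 \<in> polys V" "y * h2 \<in> polys V" using y h by (auto intro: polys_mult)
  ultimately show ?case by blast
qed

text \<open>The function equal to \<open>1\<close> on one compact set and to \<open>- 1\<close> on
  the other is continuous because the sets are closed and disjoint. A polynomial within distance
  less than 1 of it has the right strict signs, and multiplying by a positive power of the root
  keeps them.\<close>

lemma separate_semialg_unions:
  fixes V :: "'v::countable set"
  assumes V: "finite V" "x0 \<notin> V" and fin: "finite PP1" "finite PP2"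
    and PP: "\<forall>P\<in>PP1. P \<subseteq> polys V" "\<forall>P\<in>PP2. P \<subseteq> polys V"
    and disjoint: "(\<Union>P\<in>PP1. semialg_tilde x0 V P) \<inter> (\<Union>P\<in>PP2. semialg_tilde x0 V P) = {}"
  shows "\<exists>h1\<in>polys V. \<exists>h2\<in>polys V.
    (\<forall>x\<in>(\<Union>P\<in>PP1. semialg V P). 0 < eval x h1 + sqrt (norm2 V x + 1) * eval x h2) \<and>
    (\<forall>x\<in>(\<Union>P\<in>PP2. semialg V P). eval x h1 + sqrt (norm2 V x + 1) * eval x h2 < 0)"
proof -
  define C1 where "C1 = (\<Union>P\<in>PP1. semialg_tilde x0 V P)"
  define C2 where "C2 = (\<Union>P\<in>PP2. semialg_tilde x0 V P)"
  have C: "compact C1" "compact C2"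
    unfolding C1_def C2_def using fin V(1) by (auto intro!: compact_UN compact_semialg_tilde)
  have "continuous_on (C1 \<union> C2) (\<lambda>u. if u \<in> C1 then 1 else - 1 :: real)"
    using disjoint unfolding C1_def[symmetric] C2_def[symmetric]
    by (intro continuous_on_cases compact_imp_closed C) auto
  moreover have "compact (C1 \<union> C2)" using C by (rule compact_Un)
  moreover have "C1 \<union> C2 \<subseteq> space_on (insert x0 V)"
    by (auto simp: C1_def C2_def semialg_tilde_def)
  ultimately have "\<exists>q\<in>polys (insert x0 V). \<forall>u\<in>C1 \<union> C2.
      \<bar>(if u \<in> C1 then 1 else - 1) - eval u q\<bar> < 1"
    by (intro polys_dense) simp_all
  then obtain q where q: "q \<in> polys (insert x0 V)" and
    approx: "\<And>u. u \<in> C1 \<union> C2 \<Longrightarrow> \<bar>(if u \<in> C1 then 1 else - 1) - eval u q\<bar> < 1"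
    by blast
  have q1: "0 < eval u q" if "u \<in> C1" for u
    using approx[of u] that by auto
  have q2: "eval u q < 0" if "u \<in> C2" for u
    using approx[of u] that disjoint unfolding C1_def[symmetric] C2_def[symmetric]
    by (auto split: if_splits)
  obtain k h1 h2 where h: "h1 \<in> polys V" "h2 \<in> polys V"
    "\<And>x. sqrt (norm2 V x + 1) ^ k * eval (sphere_point x0 V x) q =
      eval x h1 + sqrt (norm2 V x + 1) * eval x h2"
    using sphere_polynomial_decomposition[OF q V(2)] by blast
  show ?thesis
  proof (rule bexI[OF bexI[OF _ h(2)] h(1)], intro conjI ballI)
    fix x assume "x \<in> (\<Union>P\<in>PP1. semialg V P)"
    then have "sphere_point x0 V x \<in> C1"
      using sphere_point_in_tilde[OF V(2)] PP(1) unfolding C1_def by blast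
    then show "0 < eval x h1 + sqrt (norm2 V x + 1) * eval x h2"
      unfolding h(3)[symmetric] by (intro mult_pos_pos zero_less_power sqrt_norm2_pos q1)
  next
    fix x assume "x \<in> (\<Union>P\<in>PP2. semialg V P)"
    then have "sphere_point x0 V x \<in> C2"
      using sphere_point_in_tilde[OF V(2)] PP(2) unfolding C2_def by blast
    then show "eval x h1 + sqrt (norm2 V x + 1) * eval x h2 < 0"
      unfolding h(3)[symmetric] by (intro mult_pos_neg zero_less_power sqrt_norm2_pos q2)
  qed
qed

section \<open>The interpolant\<close>

theorem theorem6:
  fixes r1 r2 r3 m n :: nat
    and f g :: "nat \<Rightarrow> var mpoly"
    and PP1 PP2 :: "var mpoly set set"
  assumes f: "\<And>i. i \<in> {1..m} \<Longrightarrow> f i \<in> polys (xvars r1 \<union> yvars r2)"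
    and g: "\<And>j. j \<in> {1..n} \<Longrightarrow> g j \<in> polys (xvars r1 \<union> zvars r3)"
    and S1: "semialg_union (xvars r1) PP1
               (closure (proj (xvars r1) ` semialg (xvars r1 \<union> yvars r2) (f ` {1..m})))"
    and S2: "semialg_union (xvars r1) PP2
               (closure (proj (xvars r1) ` semialg (xvars r1 \<union> zvars r3) (g ` {1..n})))"
    and disjoint: "(\<Union>P\<in>PP1. semialg_tilde X0 (xvars r1) P) \<inter>
                   (\<Union>P\<in>PP2. semialg_tilde X0 (xvars r1) P) = {}"
    and closed_phi: "closed_at_infinity X0 (xvars r1 \<union> yvars r2) (f ` {1..m})"
    and closed_psi: "closed_at_infinity X0 (xvars r1 \<union> zvars r3) (g ` {1..n})"
  shows "\<exists>h1\<in>polys (xvars r1). \<exists>h2\<in>polys (xvars r1).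
    interpolant (xvars r1)
      (semialg (xvars r1 \<union> yvars r2) (f ` {1..m})) (semialg (xvars r1 \<union> zvars r3) (g ` {1..n}))
      (\<lambda>x. eval x h1 + sqrt (norm2 (xvars r1) x + 1) * eval x h2) \<and>
    (\<forall>\<epsilon>>0.
      (\<exists>\<sigma>. (\<forall>i\<in>{0..m+2}. \<sigma> i \<in> sos ({X0, W} \<union> xvars r1 \<union> yvars r2)) \<and>
           (\<forall>i\<in>{m+3..m+4}. \<sigma> i \<in> polys ({X0, W} \<union> xvars r1 \<union> yvars r2)) \<and>
           homogenize X0 (h1 + Var W * h2) + Const \<epsilon> =
             \<sigma> 0 + (\<Sum>i=1..m+4. \<sigma> i * ext_family (xvars r1) (yvars r2) m f i)) \<and>
      (\<exists>\<tau>. (\<forall>j\<in>{0..n+2}. \<tau> j \<in> sos ({X0, W} \<union> xvars r1 \<union> zvars r3)) \<and>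
           (\<forall>j\<in>{n+3..n+4}. \<tau> j \<in> polys ({X0, W} \<union> xvars r1 \<union> zvars r3)) \<and>
           - homogenize X0 (h1 + Var W * h2) + Const \<epsilon> =
             \<tau> 0 + (\<Sum>j=1..n+4. \<tau> j * ext_family (xvars r1) (zvars r3) n g j)))"
proof -
  let ?X = "xvars r1" and ?Y = "yvars r2" and ?Z = "zvars r3"
  let ?S = "semialg (?X \<union> ?Y) (f ` {1..m})" and ?T = "semialg (?X \<union> ?Z) (g ` {1..n})"
  have fin: "finite ?X" "finite ?Y" "finite ?Z"
    by (simp_all add: xvars_def yvars_def zvars_def)
  have fresh: "?X \<inter> ?Y = {}" "?X \<inter> ?Z = {}" "X0 \<notin> ?X \<union> ?Y" "W \<notin> ?X \<union> ?Y"
    "X0 \<notin> ?X \<union> ?Z" "W \<notin> ?X \<union> ?Z" "X0 \<notin> ?X" "W \<notin> ?X"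
    by (auto simp: xvars_def yvars_def zvars_def)
  have PP: "finite PP1" "finite PP2" "\<forall>P\<in>PP1. P \<subseteq> polys ?X" "\<forall>P\<in>PP2. P \<subseteq> polys ?X"
    using S1 S2 by (simp_all add: semialg_union_def)
  \<comment> \<open>Chosen before any \<open>\<epsilon>\<close>, so that one pair serves all
    certificates.\<close>
  obtain h1 h2 where h: "h1 \<in> polys ?X" "h2 \<in> polys ?X" and
    h_pos: "\<forall>x\<in>(\<Union>P\<in>PP1. semialg ?X P). 0 < eval x h1 + sqrt (norm2 ?X x + 1) * eval x h2" and
    h_neg: "\<forall>x\<in>(\<Union>P\<in>PP2. semialg ?X P). eval x h1 + sqrt (norm2 ?X x + 1) * eval x h2 < 0"
    using separate_semialg_unions[OF fin(1) fresh(7) PP disjoint] by (elim bexE conjE)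
  have pos: "0 < eval (proj ?X u) h1 + sqrt (norm2 ?X (proj ?X u) + 1) * eval (proj ?X u) h2"
    if "u \<in> ?S" for u
  proof (rule h_pos[rule_format])
    have "closure (proj ?X ` ?S) = (\<Union>P\<in>PP1. semialg ?X P)"
      using S1 unfolding semialg_union_def by (elim conjE)
    then show "proj ?X u \<in> (\<Union>P\<in>PP1. semialg ?X P)"
      using closure_subset[THEN subsetD, OF imageI[OF that]] by (rule subst)
  qed
  have neg: "eval (proj ?X u) h1 + sqrt (norm2 ?X (proj ?X u) + 1) * eval (proj ?X u) h2 < 0"
    if "u \<in> ?T" for u
  proof (rule h_neg[rule_format])
    have "closure (proj ?X ` ?T) = (\<Union>P\<in>PP2. semialg ?X P)"
      using S2 unfolding semialg_union_def by (elim conjE)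
    then show "proj ?X u \<in> (\<Union>P\<in>PP2. semialg ?X P)"
      using closure_subset[THEN subsetD, OF imageI[OF that]] by (rule subst)
  qed
  let ?l = "h1 + Var W * h2"
  have l: "?l \<in> polys (insert W ?X)"
    using h by (auto intro!: polys_intros intro: polys_mono[rotated])
  \<comment> \<open>At \<open>W = sqrt (norm2 ?X u + 1)\<close> the polynomial \<open>l\<close>
    takes the value of the interpolant; this turns its sign into the hypothesis of
    \<open>homogenize_certificate\<close>.\<close>
  have eval_l: "eval ((proj ?X u)(W := sqrt (norm2 ?X u + 1))) ?l =
      eval (proj ?X u) h1 + sqrt (norm2 ?X (proj ?X u) + 1) * eval (proj ?X u) h2" for u
  proof -
    have "eval ((proj ?X u)(W := c)) p = eval (proj ?X u) p" if "p \<in> polys ?X" for p c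
      using fresh by (intro eval_cong[OF that]) auto
    moreover have "norm2 ?X (proj ?X u) = norm2 ?X u"
      by (rule norm2_cong) (simp add: proj_def)
    ultimately show ?thesis using h by (simp add: eval_simps)
  qed
  have "interpolant ?X ?S ?T (\<lambda>x. eval x h1 + sqrt (norm2 ?X x + 1) * eval x h2)"
    using pos neg by (simp add: interpolant_def)
  moreover have "\<exists>\<sigma>. (\<forall>i\<in>{0..m+2}. \<sigma> i \<in> sos ({X0, W} \<union> ?X \<union> ?Y)) \<and>
      (\<forall>i\<in>{m+3..m+4}. \<sigma> i \<in> polys ({X0, W} \<union> ?X \<union> ?Y)) \<and>
      homogenize X0 ?l + Const \<epsilon> = \<sigma> 0 + (\<Sum>i=1..m+4. \<sigma> i * ext_family ?X ?Y m f i)"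
    if "0 < \<epsilon>" for \<epsilon>
    using pos that
    by (intro homogenize_certificate[OF fin(1,2) fresh(1,3,4) f closed_phi l]) (simp_all only: eval_l)
  moreover have "\<exists>\<tau>. (\<forall>j\<in>{0..n+2}. \<tau> j \<in> sos ({X0, W} \<union> ?X \<union> ?Z)) \<and>
      (\<forall>j\<in>{n+3..n+4}. \<tau> j \<in> polys ({X0, W} \<union> ?X \<union> ?Z)) \<and>
      - homogenize X0 ?l + Const \<epsilon> = \<tau> 0 + (\<Sum>j=1..n+4. \<tau> j * ext_family ?X ?Z n g j)"
    if "0 < \<epsilon>" for \<epsilon>
    \<comment> \<open>The certificate for \<psi> is the one for \<open>- l\<close>, which is
      positive where the interpolant is negative.\<close>
    unfolding homogenize_uminus[symmetric] using neg that
    by (intro homogenize_certificate[OF fin(1,3) fresh(2,5,6) g closed_psi polys_uminus[OF l]])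
       (simp_all only: eval_uminus eval_l neg_0_less_iff_less)
  ultimately show ?thesis
    using h by blast
qed

end
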